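(* Let $X$ be a Riemann surface and let $\mathcal{V}$ be a projectively flat holomorphic vector bundle of rank $n$ over $X$. The class of $\mathrm{div}(A)$ in the Picard group $\mathrm{Pic}(X)$ is independent of the choice of the generic meromorphic section $A$ of $\mathcal{V}$; that is, for any two generic meromorphic sections $A$ and $B$ of $\mathcal{V}$, the divisors $\mathrm{div}(A)$ and $\mathrm{div}(B)$ define the same class in $\mathrm{Pic}(X)$.
   Context: Riemann surfaces are connected. A holomorphic vector bundle $\mathcal{V}$ of rank $n$ over $X$ is projectively flat if there are an open cover $\{U_i\}$ of $X$ and holomorphic trivializations of $\mathcal{V}$ over the $U_i$ whose transition functions on $U_i\cap U_j$ have the form $\lambda_{ij}T_{ij}$, with $\lambda_{ij}:U_i\cap U_j\to\mathbb{C}^\times$ holomorphic and $T_{ij}\in GL_n(\mathbb{C})$ constant. Such a structure is regarded as fixed; a projectively flat trivialization means a local trivialization related to those of the structure by transition functions of this form (nowhere-zero holomorphic scalar times locally constant invertible matrix). Local sections are written as row vectors of component functions, so $A_i=\lambda_{ij}A_jT_{ij}$. On a (connected) coordinate chart $U$ with coordinate $z$ and a projectively flat trivialization over $U$, a meromorphic section $A$ has components $(a_1,\dots,a_n)$; its Wronskian matrix $W(A)$ is the $n\times n$ matrix whose $i$-th row is $(a_1^{(i-1)},\dots,a_n^{(i-1)})$, $i=1,\dots,n$ (derivatives with respect to $z$), and $w(A)=\det W(A)$. The section $A$ is generic if $w(A)\not\equiv 0$ (independent of choices). The function $w(A)$ depends on the chart and the projectively flat trivialization, but its divisor does not; the resulting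 global divisor on $X$ is denoted $\mathrm{div}(A)$. *)

theory Defs
  imports
    "HOL-Algebra.Coset"
    "HOL-Complex_Analysis.Complex_Analysis"
    "Jordan_Normal_Form.Determinant"
begin

text \<open>Both the analysis library and the matrix library have a type and a
  constant called \<open>vec\<close> and a function \<open>det\<close>; below they always refer to the matrix library,
  whose vectors and matrices have their dimension as a natural number.\<close>

hide_type (open) Finite_Cartesian_Product.vec
hide_const (open) Finite_Cartesian_Product.vec Determinants.det
unbundle no vec_syntax


section \<open>Riemann surfaces\<close>

text \<open>The points of the surface are all the points of a Hausdorff space \<^typ>\<open>'a::t2_space\<close>. A chart
  is a domain \<open>U\<close> together with a coordinate \<open>\<phi>\<close>, of which only the values on \<open>U\<close> matter.\<close>

type_synonym 'a coordinate = "'a set \<times> ('a \<Rightarrow> complex)"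

definition coordinate_chart :: "'a::t2_space set \<Rightarrow> ('a \<Rightarrow> complex) \<Rightarrow> bool" where
  "coordinate_chart U \<phi> \<longleftrightarrow>
     open U \<and> open (\<phi> ` U) \<and> homeomorphism U (\<phi> ` U) \<phi> (inv_into U \<phi>)"

definition compatible_charts :: "'a coordinate \<Rightarrow> 'a coordinate \<Rightarrow> bool" where
  "compatible_charts = (\<lambda>(U, \<phi>) (V, \<chi>).
     (\<chi> \<circ> inv_into U \<phi>) holomorphic_on \<phi> ` (U \<inter> V) \<and>
     (\<phi> \<circ> inv_into V \<chi>) holomorphic_on \<chi> ` (U \<inter> V))"

text \<open>Second countability is not required: it follows from the other axioms (Rado).\<close>

locale riemann_surface =
  fixes \<A> :: "('a::t2_space) coordinate set"
  assumes connected_surface: "connected (UNIV :: 'a set)"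
    and charts: "(U, \<phi>) \<in> \<A> \<Longrightarrow> coordinate_chart U \<phi>"
    and charts_cover: "(\<Union>(U, \<phi>)\<in>\<A>. U) = UNIV"
    and charts_compatible: "c \<in> \<A> \<Longrightarrow> d \<in> \<A> \<Longrightarrow> compatible_charts c d"

text \<open>The charts of the maximal atlas.\<close>

definition holomorphic_chart ::
    "('a::t2_space) coordinate set \<Rightarrow> 'a set \<Rightarrow> ('a \<Rightarrow> complex) \<Rightarrow> bool" where
  "holomorphic_chart \<A> U \<phi> \<longleftrightarrow>
     coordinate_chart U \<phi> \<and> (\<forall>c\<in>\<A>. compatible_charts (U, \<phi>) c)"

definition surface_holomorphic_on ::
    "('a::t2_space) coordinate set \<Rightarrow> ('a \<Rightarrow> complex) \<Rightarrow> 'a set \<Rightarrow> bool" where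
  "surface_holomorphic_on \<A> f S \<longleftrightarrow>
     (\<forall>(U, \<phi>)\<in>\<A>. (f \<circ> inv_into U \<phi>) holomorphic_on \<phi> ` (U \<inter> S))"

text \<open>As for \<^const>\<open>meromorphic_on\<close>, a meromorphic function is represented by a total function;
  its values at the poles (and more generally on any discrete closed set) are irrelevant.\<close>

definition surface_meromorphic_on ::
    "('a::t2_space) coordinate set \<Rightarrow> ('a \<Rightarrow> complex) \<Rightarrow> 'a set \<Rightarrow> bool" where
  "surface_meromorphic_on \<A> f S \<longleftrightarrow>
     (\<forall>(U, \<phi>)\<in>\<A>. (f \<circ> inv_into U \<phi>) meromorphic_on \<phi> ` (U \<inter> S))"

text \<open>\<open>f \<not>\<equiv> 0\<close> on \<open>S\<close> as a meromorphic function, that is, disregarding values on discrete sets.\<close>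

definition not_identically_zero_on :: "('b::topological_space \<Rightarrow> complex) \<Rightarrow> 'b set \<Rightarrow> bool" where
  "not_identically_zero_on f S \<longleftrightarrow> (\<exists>x\<in>S. \<exists>\<^sub>F y in at x. f y \<noteq> 0)"


section \<open>Divisors and the Picard group\<close>

text \<open>Divisors on a surface that need not be compact: integer-valued functions with locally finite
  support. The Picard group is the group of divisors modulo linear equivalence.\<close>

definition divisor_group :: "('a::t2_space \<Rightarrow> int) monoid" where
  "divisor_group =
     \<lparr>carrier = {D. \<forall>x. \<exists>N. open N \<and> x \<in> N \<and> finite {y\<in>N. D y \<noteq> 0}},
      monoid.mult = (\<lambda>D E x. D x + E x),
      one = (\<lambda>x. 0)\<rparr>"

text \<open>The order at \<open>x\<close>, the common value of \<^const>\<open>zorder\<close> in all the charts around \<open>x\<close>.\<close>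

definition surface_order ::
    "('a::t2_space) coordinate set \<Rightarrow> ('a \<Rightarrow> complex) \<Rightarrow> 'a \<Rightarrow> int" where
  "surface_order \<A> f x =
     (THE k. \<forall>(U, \<phi>)\<in>\<A>. x \<in> U \<longrightarrow> zorder (f \<circ> inv_into U \<phi>) (\<phi> x) = k)"

definition principal_divisors :: "('a::t2_space) coordinate set \<Rightarrow> ('a \<Rightarrow> int) set" where
  "principal_divisors \<A> =
     {surface_order \<A> f | f. surface_meromorphic_on \<A> f UNIV \<and> not_identically_zero_on f UNIV}"

definition picard_group :: "('a::t2_space) coordinate set \<Rightarrow> ('a \<Rightarrow> int) set monoid" where
  "picard_group \<A> = divisor_group Mod principal_divisors \<A>"

definition divisor_class ::
    "('a::t2_space) coordinate set \<Rightarrow> ('a \<Rightarrow> int) \<Rightarrow> ('a \<Rightarrow> int) set" where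
  "divisor_class \<A> D = principal_divisors \<A> #>\<^bsub>divisor_group\<^esub> D"


section \<open>Projectively flat vector bundles\<close>

definition row_mult :: "complex Matrix.vec \<Rightarrow> complex mat \<Rightarrow> complex Matrix.vec" where
  "row_mult v M = transpose_mat M *\<^sub>v v"

definition GL_mat :: "nat \<Rightarrow> complex mat set" where
  "GL_mat n = {M \<in> carrier_mat n n. invertible_mat M}"

text \<open>The total space of a bundle is a type \<open>'e\<close> with a projection \<open>p\<close>. A trivialization over \<open>V\<close> is
  given by its row vector \<open>\<psi>\<close> of fibre coordinates; only the values of \<open>\<psi>\<close> over \<open>V\<close> matter.\<close>

type_synonym ('a, 'e) trivialization = "'a set \<times> ('e \<Rightarrow> complex Matrix.vec)"

definition trivialization_over ::
    "nat \<Rightarrow> ('e \<Rightarrow> 'a::t2_space) \<Rightarrow> 'a set \<Rightarrow> ('e \<Rightarrow> complex Matrix.vec) \<Rightarrow> bool" where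
  "trivialization_over n p V \<psi> \<longleftrightarrow>
     open V \<and> (\<forall>x\<in>V. bij_betw \<psi> (p -` {x}) (carrier_vec n))"

definition holomorphic_transition ::
    "('a::t2_space) coordinate set \<Rightarrow> nat \<Rightarrow> ('e \<Rightarrow> 'a) \<Rightarrow>
     ('a, 'e) trivialization \<Rightarrow> ('a, 'e) trivialization \<Rightarrow> bool" where
  "holomorphic_transition \<A> n p = (\<lambda>(V, \<psi>) (V', \<psi>').
     \<exists>g. (\<forall>x\<in>V \<inter> V'. g x \<in> GL_mat n) \<and>
         (\<forall>i<n. \<forall>j<n. surface_holomorphic_on \<A> (\<lambda>x. g x $$ (i, j)) (V \<inter> V')) \<and>
         (\<forall>e. p e \<in> V \<inter> V' \<longrightarrow> \<psi> e = row_mult (\<psi>' e) (g (p e))))"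

text \<open>A holomorphic vector bundle is given by a bundle atlas \<open>\<B>\<close> with holomorphic \<open>GL_n\<close>-valued
  transition functions. The vector space structure of the fibres and the topology and complex
  structure of the total space are those transported by the trivializations in \<open>\<B>\<close>.\<close>

locale holomorphic_vector_bundle = riemann_surface \<A>
  for \<A> :: "('a::t2_space) coordinate set" +
  fixes n :: nat
    and p :: "'e \<Rightarrow> 'a"
    and \<B> :: "('a, 'e) trivialization set"
  assumes trivializations: "(V, \<psi>) \<in> \<B> \<Longrightarrow> trivialization_over n p V \<psi>"
    and trivializations_cover: "(\<Union>(V, \<psi>)\<in>\<B>. V) = UNIV"
    and transitions_holomorphic: "t \<in> \<B> \<Longrightarrow> t' \<in> \<B> \<Longrightarrow> holomorphic_transition \<A> n p t t'"

definition nonvanishing_holomorphic_on ::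
    "('a::t2_space) coordinate set \<Rightarrow> ('a \<Rightarrow> complex) \<Rightarrow> 'a set \<Rightarrow> bool" where
  "nonvanishing_holomorphic_on \<A> l S \<longleftrightarrow>
     surface_holomorphic_on \<A> l S \<and> (\<forall>x\<in>S. l x \<noteq> 0)"

text \<open>A projectively flat structure: holomorphic trivializations of the bundle over an open cover
  with transition functions \<open>\<lambda>\<^sub>i\<^sub>j T\<^sub>i\<^sub>j\<close>, the matrix \<open>T\<^sub>i\<^sub>j\<close> being constant on the whole
  (possibly disconnected) overlap.\<close>

locale projectively_flat_bundle = holomorphic_vector_bundle \<A> n p \<B>
  for \<A> :: "('a::t2_space) coordinate set" and n :: nat
    and p :: "'e \<Rightarrow> 'a" and \<B> :: "('a, 'e) trivialization set" +
  fixes \<F> :: "('a, 'e) trivialization set"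
  assumes flat_trivializations: "(V, \<psi>) \<in> \<F> \<Longrightarrow> trivialization_over n p V \<psi>"
    and flat_holomorphic: "t \<in> \<F> \<Longrightarrow> t' \<in> \<B> \<Longrightarrow> holomorphic_transition \<A> n p t t'"
    and flat_cover: "(\<Union>(V, \<psi>)\<in>\<F>. V) = UNIV"
    and flat_transitions: "(V, \<psi>) \<in> \<F> \<Longrightarrow> (V', \<psi>') \<in> \<F> \<Longrightarrow>
      \<exists>l. \<exists>T\<in>GL_mat n. nonvanishing_holomorphic_on \<A> l (V \<inter> V') \<and>
        (\<forall>e. p e \<in> V \<inter> V' \<longrightarrow> \<psi> e = l (p e) \<cdot>\<^sub>v row_mult (\<psi>' e) T)"

text \<open>The trivializations admitted by the structure \<open>\<F>\<close>; here the matrix is only locally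
  constant.\<close>

definition flat_trivialization ::
    "('a::t2_space) coordinate set \<Rightarrow> nat \<Rightarrow> ('e \<Rightarrow> 'a) \<Rightarrow> ('a, 'e) trivialization set \<Rightarrow>
     'a set \<Rightarrow> ('e \<Rightarrow> complex Matrix.vec) \<Rightarrow> bool" where
  "flat_trivialization \<A> n p \<F> V \<psi> \<longleftrightarrow>
     trivialization_over n p V \<psi> \<and>
     (\<forall>(V', \<psi>')\<in>\<F>. \<exists>l T.
        nonvanishing_holomorphic_on \<A> l (V \<inter> V') \<and>
        (\<forall>x\<in>V \<inter> V'. T x \<in> GL_mat n \<and>
           (\<exists>N. open N \<and> x \<in> N \<and> (\<forall>y\<in>N \<inter> V \<inter> V'. T y = T x))) \<and>
        (\<forall>e. p e \<in> V \<inter> V' \<longrightarrow> \<psi> e = l (p e) \<cdot>\<^sub>v row_mult (\<psi>' e) (T (p e))))"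


section \<open>Meromorphic sections, Wronskians and their divisors\<close>

text \<open>A meromorphic section is represented by a total section whose values at the poles are
  irrelevant.\<close>

definition meromorphic_section ::
    "('a::t2_space) coordinate set \<Rightarrow> nat \<Rightarrow> ('e \<Rightarrow> 'a) \<Rightarrow> ('a, 'e) trivialization set \<Rightarrow>
     ('a \<Rightarrow> 'e) \<Rightarrow> bool" where
  "meromorphic_section \<A> n p \<B> s \<longleftrightarrow>
     (\<forall>x. p (s x) = x) \<and>
     (\<forall>(V, \<psi>)\<in>\<B>. \<forall>j<n. surface_meromorphic_on \<A> (\<lambda>x. vec_index (\<psi> (s x)) j) V)"

definition wronskian_mat :: "nat \<Rightarrow> (complex \<Rightarrow> complex Matrix.vec) \<Rightarrow> complex \<Rightarrow> complex mat" where
  "wronskian_mat n a z = mat n n (\<lambda>(i, j). (deriv ^^ i) (\<lambda>\<zeta>. vec_index (a \<zeta>) j) z)"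

text \<open>The function \<open>w(s)\<close>, in the coordinate \<open>\<phi>\<close> on \<open>U\<close> and the trivialization \<open>\<psi>\<close>, as a
  meromorphic function on \<open>\<phi> ` U\<close>.\<close>

definition section_wronskian ::
    "nat \<Rightarrow> ('a \<Rightarrow> 'e) \<Rightarrow> 'a set \<Rightarrow> ('a \<Rightarrow> complex) \<Rightarrow> ('e \<Rightarrow> complex Matrix.vec) \<Rightarrow>
     complex \<Rightarrow> complex" where
  "section_wronskian n s U \<phi> \<psi> z =
     Determinant.det (wronskian_mat n (\<psi> \<circ> s \<circ> inv_into U \<phi>) z)"

definition flat_chart ::
    "('a::t2_space) coordinate set \<Rightarrow> nat \<Rightarrow> ('e \<Rightarrow> 'a) \<Rightarrow> ('a, 'e) trivialization set \<Rightarrow>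
     'a set \<Rightarrow> ('a \<Rightarrow> complex) \<Rightarrow> ('e \<Rightarrow> complex Matrix.vec) \<Rightarrow> bool" where
  "flat_chart \<A> n p \<F> U \<phi> \<psi> \<longleftrightarrow>
     connected U \<and> holomorphic_chart \<A> U \<phi> \<and> flat_trivialization \<A> n p \<F> U \<psi>"

text \<open>The condition does not depend on the chart and the trivialization, so that it suffices to
  ask it for one of them.\<close>

definition generic_section ::
    "('a::t2_space) coordinate set \<Rightarrow> nat \<Rightarrow> ('e \<Rightarrow> 'a) \<Rightarrow> ('a, 'e) trivialization set \<Rightarrow>
     ('a \<Rightarrow> 'e) \<Rightarrow> bool" where
  "generic_section \<A> n p \<F> s \<longleftrightarrow>
     (\<exists>U \<phi> \<psi>. flat_chart \<A> n p \<F> U \<phi> \<psi> \<and>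
        not_identically_zero_on (section_wronskian n s U \<phi> \<psi>) (\<phi> ` U))"

text \<open>The order of \<open>w(s)\<close> at \<open>x\<close>, which is the same for all charts and projectively flat
  trivializations around \<open>x\<close>.\<close>

definition section_divisor ::
    "('a::t2_space) coordinate set \<Rightarrow> nat \<Rightarrow> ('e \<Rightarrow> 'a) \<Rightarrow> ('a, 'e) trivialization set \<Rightarrow>
     ('a \<Rightarrow> 'e) \<Rightarrow> 'a \<Rightarrow> int" where
  "section_divisor \<A> n p \<F> s x =
     (THE k. \<forall>U \<phi> \<psi>. flat_chart \<A> n p \<F> U \<phi> \<psi> \<and> x \<in> U \<longrightarrow>
        zorder (section_wronskian n s U \<phi> \<psi>) (\<phi> x) = k)"

end

theory Submission
  imports Defs
begin

text \<open>
  Let \<open>a\<close> and \<open>b\<close> be the component vectors of a section in two flat charts, so that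
  \<open>a = l \<cdot> (b \<circ> h) T\<close> with \<open>l\<close> nowhere zero, \<open>h\<close> the change of coordinate and \<open>T\<close> constant. The
  Wronskian matrix of \<open>a\<close> is that of \<open>b\<close>, composed with \<open>h\<close>, multiplied by \<open>T\<close> on the right and by
  a lower triangular matrix with diagonal entries \<open>l \<cdot> h'^i\<close> on the left. Hence the two Wronskians
  differ by the nowhere vanishing holomorphic factor \<open>l^n \<cdot> h'^(n(n-1)/2) \<cdot> det T\<close>, which does not
  depend on the section. So the order of \<open>w(A)\<close> is well defined, and the quotients \<open>w(A) / w(B)\<close>
  glue to a global meromorphic function whose divisor is \<open>div(A) - div(B)\<close>. It is nonzero because,
  the surface being connected, the Wronskian of a generic section vanishes identically near no point.
\<close>

section \<open>Change of frame for Wronskians\<close>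

text \<open>A meromorphic function is a total function with arbitrary values at its poles, so the
  Wronskian identity between two frames cannot be claimed at every point. It is available where the
  components are analytic, hence on punctured neighbourhoods; zeros are therefore discussed through
  the filter \<open>at x\<close>, and the identity principle is proved for statements of that kind.
  A second constraint comes from the quotient w(A) / w(B): both Wronskians must pick up literally
  the same factor, so the factor is built before any section is quantified, beginning with the
  coefficients \<open>c\<close> below. A third one is that the data live in different atlases:
  holomorphy is tested in the charts of \<open>\<A>\<close>, the section is meromorphic in the
  frames of \<open>\<B>\<close>, and a flat chart has a coordinate from the maximal atlas and a
  trivialization compared only with \<open>\<F>\<close>. Comparisons are therefore local, through a
  chart or frame of the given families around the point.\<close>

text \<open>Product and chain rule turn c_k u^(k)(h) into c_k' u^(k)(h) + c_k h' u^(k+1)(h), which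
  dictates the recursion for \<open>c\<close>. For l = 1 these are the partial Bell polynomials of
  Faa di Bruno's formula. They are obtained before \<open>u\<close>, so that one triangular matrix
  serves all components of all sections.\<close>

lemma higher_deriv_weighted_compose:
  fixes l h :: "complex \<Rightarrow> complex"
  assumes S: "open S" and l: "l holomorphic_on S" and h: "h holomorphic_on S"
  obtains c :: "nat \<Rightarrow> nat \<Rightarrow> complex \<Rightarrow> complex" where
    "\<And>i k. c i k holomorphic_on S"
    "\<And>i k z. i < k \<Longrightarrow> z \<in> S \<Longrightarrow> c i k z = 0"
    "\<And>i z. z \<in> S \<Longrightarrow> c i i z = l z * deriv h z ^ i"
    "\<And>u S' i z. open S' \<Longrightarrow> u holomorphic_on S' \<Longrightarrow> z \<in> S \<Longrightarrow> h z \<in> S' \<Longrightarrow>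
       (deriv ^^ i) (\<lambda>\<zeta>. l \<zeta> * u (h \<zeta>)) z = (\<Sum>k\<le>i. c i k z * (deriv ^^ k) u (h z))"
proof -
  \<comment> \<open>The recursion runs over rows, with the whole row \<open>d\<close> as its value,
    because entry k of the next row uses entries k and k - 1. The test k = 0 guards the truncated
    subtraction.\<close>
  define c :: "nat \<Rightarrow> nat \<Rightarrow> complex \<Rightarrow> complex" where "c = rec_nat (\<lambda>k z. if k = 0 then l z else 0)
    (\<lambda>_ d k z. deriv (d k) z + (if k = 0 then 0 else d (k - 1) z * deriv h z))"
  have c0: "c 0 k = (\<lambda>z. if k = 0 then l z else 0)" for k
    by (simp add: c_def)
  have cS: "c (Suc i) k = (\<lambda>z. deriv (c i k) z + (if k = 0 then 0 else c i (k - 1) z * deriv h z))"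
    for i k
    by (simp add: c_def cong: if_cong)
  have hol: "c i k holomorphic_on S" for i k
  proof (induction i arbitrary: k)
    case 0
    then show ?case using l by (cases "k = 0") (auto simp: c0)
  next
    case (Suc i)
    have "deriv (c i k) holomorphic_on S" "deriv h holomorphic_on S"
      by (intro holomorphic_deriv Suc h S)+
    then show ?case
      unfolding cS using Suc by (cases "k = 0") (simp_all add: holomorphic_on_add holomorphic_on_mult)
  qed
  have zero: "c i k z = 0" if "i < k" "z \<in> S" for i k z
    using that
  proof (induction i arbitrary: k z)
    case 0
    then show ?case by (simp add: c0)
  next
    case (Suc i)
    \<comment> \<open>\<open>c i k\<close> vanishes on the whole open set \<open>S\<close>, so its
      derivative vanishes there too.\<close>
    have "deriv (c i k) z = deriv (\<lambda>_. 0) z"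
      by (rule complex_derivative_transform_within_open[OF hol _ S]) (use Suc in auto)
    with Suc show ?case by (simp add: cS)
  qed
  have diag: "c i i z = l z * deriv h z ^ i" if "z \<in> S" for i z
    using that
  proof (induction i arbitrary: z)
    case 0
    then show ?case by (simp add: c0)
  next
    case (Suc i)
    have "deriv (c i (Suc i)) z = deriv (\<lambda>_. 0) z"
      by (rule complex_derivative_transform_within_open[OF hol _ S]) (use Suc zero in auto)
    with Suc show ?case by (simp add: cS)
  qed
  have main: "(deriv ^^ i) (\<lambda>\<zeta>. l \<zeta> * u (h \<zeta>)) z = (\<Sum>k\<le>i. c i k z * (deriv ^^ k) u (h z))"
    if S': "open S'" and u: "u holomorphic_on S'" and "z \<in> S" "h z \<in> S'" for u S' i z
    using that(3,4)
  proof (induction i arbitrary: z)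
    case 0
    then show ?case by (simp add: c0)
  next
    case (Suc i)
    \<comment> \<open>The induction hypothesis holds on all of \<open>R\<close>, an open
      neighbourhood of \<open>z\<close>, and can therefore be differentiated at
      \<open>z\<close>.\<close>
    define R where "R = S \<inter> h -` S'"
    have R: "open R"
      unfolding R_def using S S' h holomorphic_on_imp_continuous_on continuous_open_preimage by blast
    have zR: "z \<in> R" using Suc.prems by (auto simp: R_def)
    have dc: "(c i k has_field_derivative deriv (c i k) z) (at z)" for k
      using holomorphic_derivI[OF hol S] Suc.prems by auto
    have "(h has_field_derivative deriv h z) (at z)"
      using holomorphic_derivI[OF h S] Suc.prems by auto
    moreover have "((deriv ^^ k) u has_field_derivative (deriv ^^ Suc k) u (h z)) (at (h z))" for k
      using has_field_derivative_higher_deriv[OF u S'] Suc.prems by blast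
    ultimately have du: "((\<lambda>\<zeta>. (deriv ^^ k) u (h \<zeta>)) has_field_derivative
        (deriv ^^ Suc k) u (h z) * deriv h z) (at z)" for k
      using DERIV_chain2 by blast
    have eq: "(deriv ^^ i) (\<lambda>\<zeta>. l \<zeta> * u (h \<zeta>)) w = (\<Sum>k\<le>i. c i k w * (deriv ^^ k) u (h w))"
      if "w \<in> R" for w
      using Suc.IH that by (auto simp: R_def)
    have "((\<lambda>w. \<Sum>k\<le>i. c i k w * (deriv ^^ k) u (h w)) has_field_derivative
        (\<Sum>k\<le>i. deriv (c i k) z * (deriv ^^ k) u (h z) +
          (deriv ^^ Suc k) u (h z) * deriv h z * c i k z)) (at z)"
      by (intro DERIV_sum DERIV_mult dc du)
    then have "((deriv ^^ i) (\<lambda>\<zeta>. l \<zeta> * u (h \<zeta>)) has_field_derivative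
        (\<Sum>k\<le>i. deriv (c i k) z * (deriv ^^ k) u (h z) +
          (deriv ^^ Suc k) u (h z) * deriv h z * c i k z)) (at z)"
      by (rule has_field_derivative_transform_within_open[OF _ R zR]) (simp add: eq)
    then have "(deriv ^^ Suc i) (\<lambda>\<zeta>. l \<zeta> * u (h \<zeta>)) z =
        (\<Sum>k\<le>i. deriv (c i k) z * (deriv ^^ k) u (h z)) +
        (\<Sum>k\<le>i. (deriv ^^ Suc k) u (h z) * deriv h z * c i k z)"
      using DERIV_imp_deriv by (auto simp: sum.distrib)
    \<comment> \<open>Both sums are brought to the range k \<le> Suc i. The term added here contains
      the derivative of \<open>c i (Suc i)\<close>, a function that vanishes on \<open>S\<close>;
      the other sum is shifted by one.\<close>
    also have "(\<Sum>k\<le>i. deriv (c i k) z * (deriv ^^ k) u (h z)) =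
        (\<Sum>k\<le>Suc i. deriv (c i k) z * (deriv ^^ k) u (h z))"
    proof -
      have "deriv (c i (Suc i)) z = deriv (\<lambda>_. 0) z"
        by (rule complex_derivative_transform_within_open[OF hol _ S]) (use Suc zero in auto)
      then show ?thesis by simp
    qed
    also have "(\<Sum>k\<le>i. (deriv ^^ Suc k) u (h z) * deriv h z * c i k z) =
        (\<Sum>k\<le>Suc i. (if k = 0 then 0 else c i (k - 1) z * deriv h z) * (deriv ^^ k) u (h z))"
      by (subst sum.atMost_Suc_shift) (simp add: mult_ac)
    finally show ?case
      by (simp only: cS sum.distrib distrib_right)
  qed
  show ?thesis
    by (rule that[of c]) (use hol zero diag main in auto)
qed

lemma higher_deriv_sum_cmult:
  assumes "finite J" "open S" "z \<in> S" "\<And>j. j \<in> J \<Longrightarrow> f j holomorphic_on S"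
  shows "(deriv ^^ k) (\<lambda>\<zeta>. \<Sum>j\<in>J. t j * f j \<zeta>) z = (\<Sum>j\<in>J. t j * (deriv ^^ k) (f j) z)"
  using assms(1,4)
proof (induction J rule: finite_induct)
  case (insert j J)
  have "(deriv ^^ k) (\<lambda>\<zeta>. t j * f j \<zeta> + (\<Sum>j\<in>J. t j * f j \<zeta>)) z =
      (deriv ^^ k) (\<lambda>\<zeta>. t j * f j \<zeta>) z + (deriv ^^ k) (\<lambda>\<zeta>. \<Sum>j\<in>J. t j * f j \<zeta>) z"
    using insert.prems by (intro higher_deriv_add[of _ S]) (auto intro!: holomorphic_intros assms(2,3))
  with insert assms(2,3) show ?case
    using higher_deriv_cmult[of "f j" S z k "t j"] by simp
qed auto

text \<open>The matrix relating the two Wronskian matrices is lower triangular: the \<open>i\<close>-th derivative of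
  \<open>l \<cdot> (u \<circ> h)\<close> only involves derivatives of \<open>u\<close> of order at most \<open>i\<close>.\<close>

lemma det_wronskian_change:
  assumes S: "open S" and l: "l holomorphic_on S" and h: "h holomorphic_on S"
    and T: "T \<in> carrier_mat n n"
    and a: "\<And>\<zeta> j. \<zeta> \<in> S \<Longrightarrow> j < n \<Longrightarrow>
      vec_index (a \<zeta>) j = l \<zeta> * (\<Sum>m<n. T $$ (m, j) * vec_index (b (h \<zeta>)) m)"
    and z: "z \<in> S"
    and b: "\<And>m. m < n \<Longrightarrow> (\<lambda>\<zeta>. vec_index (b \<zeta>) m) analytic_on {h z}"
  shows "Determinant.det (wronskian_mat n a z) =
    (\<Prod>i<n. l z * deriv h z ^ i) * Determinant.det T * Determinant.det (wronskian_mat n b (h z))"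
proof -
  obtain c :: "nat \<Rightarrow> nat \<Rightarrow> complex \<Rightarrow> complex"
    where "\<And>i k. c i k holomorphic_on S"
    and c: "\<And>i k z. i < k \<Longrightarrow> z \<in> S \<Longrightarrow> c i k z = 0"
    "\<And>i z. z \<in> S \<Longrightarrow> c i i z = l z * deriv h z ^ i"
    "\<And>u S' i z. open S' \<Longrightarrow> u holomorphic_on S' \<Longrightarrow> z \<in> S \<Longrightarrow> h z \<in> S' \<Longrightarrow>
       (deriv ^^ i) (\<lambda>\<zeta>. l \<zeta> * u (h \<zeta>)) z = (\<Sum>k\<le>i. c i k z * (deriv ^^ k) u (h z))"
    by (rule higher_deriv_weighted_compose[OF S l h]) (rule that)
  define C where "C = mat n n (\<lambda>(i, k). c i k z)"
  have C[simp]: "C \<in> carrier_mat n n" by (simp add: C_def)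
  have "\<forall>m\<in>{..<n}. \<exists>e>0. (\<lambda>\<zeta>. vec_index (b \<zeta>) m) holomorphic_on ball (h z) e"
    using b by (auto simp: analytic_on_def)
  then obtain e where e: "\<And>m. m < n \<Longrightarrow> e m > 0 \<and> (\<lambda>\<zeta>. vec_index (b \<zeta>) m) holomorphic_on ball (h z) (e m)"
    by (metis lessThan_iff)
  \<comment> \<open>A common disc of holomorphy for the finitely many components; the inserted 1
    keeps \<open>Min\<close> meaningful for n = 0.\<close>
  define S' where "S' = ball (h z) (Min (insert 1 (e ` {..<n})))"
  have S': "open S'" "h z \<in> S'" using e by (auto simp: S'_def)
  have bS': "(\<lambda>\<zeta>. vec_index (b \<zeta>) m) holomorphic_on S'" if "m < n" for m
    using e[OF that] that by (auto simp: S'_def elim!: holomorphic_on_subset)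
  have entry: "(deriv ^^ i) (\<lambda>\<zeta>. vec_index (a \<zeta>) j) z =
      (\<Sum>k<n. \<Sum>m<n. C $$ (i, k) * (wronskian_mat n b (h z) $$ (k, m) * T $$ (m, j)))"
    if ij: "i < n" "j < n" for i j
  proof -
    define u where "u = (\<lambda>\<zeta>. \<Sum>m<n. T $$ (m, j) * vec_index (b \<zeta>) m)"
    have u: "u holomorphic_on S'"
      unfolding u_def by (intro holomorphic_intros bS') auto
    have "eventually (\<lambda>\<zeta>. vec_index (a \<zeta>) j = l \<zeta> * u (h \<zeta>)) (nhds z)"
      using eventually_nhds_in_open[OF S z]
      by eventually_elim (use a ij in \<open>auto simp: u_def\<close>)
    then have "(deriv ^^ i) (\<lambda>\<zeta>. vec_index (a \<zeta>) j) z = (deriv ^^ i) (\<lambda>\<zeta>. l \<zeta> * u (h \<zeta>)) z"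
      by (rule higher_deriv_cong_ev) simp
    also have "\<dots> = (\<Sum>k\<le>i. c i k z * (deriv ^^ k) u (h z))"
      by (rule c(3)[OF S'(1) u z S'(2)])
    \<comment> \<open>Triangularity allows the full range of a matrix product: the terms with k > i
      are zero.\<close>
    also have "\<dots> = (\<Sum>k<n. c i k z * (deriv ^^ k) u (h z))"
      by (rule sum.mono_neutral_left) (use ij c(1) z in auto)
    also have "\<dots> = (\<Sum>k<n. \<Sum>m<n. C $$ (i, k) * (wronskian_mat n b (h z) $$ (k, m) * T $$ (m, j)))"
    proof (rule sum.cong[OF refl])
      fix k assume "k \<in> {..<n}"
      have "(deriv ^^ k) u (h z) = (\<Sum>m<n. T $$ (m, j) * (deriv ^^ k) (\<lambda>\<zeta>. vec_index (b \<zeta>) m) (h z))"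
        unfolding u_def by (rule higher_deriv_sum_cmult[OF _ S']) (auto intro: bS')
      then show "c i k z * (deriv ^^ k) u (h z) =
          (\<Sum>m<n. C $$ (i, k) * (wronskian_mat n b (h z) $$ (k, m) * T $$ (m, j)))"
        using \<open>k \<in> {..<n}\<close> ij by (simp add: sum_distrib_left C_def wronskian_mat_def mult_ac)
    qed
    finally show ?thesis .
  qed
  have W[simp]: "wronskian_mat n b y \<in> carrier_mat n n" for b y
    by (simp add: wronskian_mat_def)
  have "wronskian_mat n a z = C * (wronskian_mat n b (h z) * T)"
  proof (rule eq_matI)
    fix i j assume "i < dim_row (C * (wronskian_mat n b (h z) * T))"
      "j < dim_col (C * (wronskian_mat n b (h z) * T))"
    then have ij: "i < n" "j < n" using C T by auto
    have "(C * (wronskian_mat n b (h z) * T)) $$ (i, j) =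
        (\<Sum>k<n. C $$ (i, k) * (wronskian_mat n b (h z) * T) $$ (k, j))"
      using ij T carrier_matD[OF C] carrier_matD[OF W[of b "h z"]]
      by (simp add: scalar_prod_def atLeast0LessThan)
    also have "\<dots> = (\<Sum>k<n. C $$ (i, k) * (\<Sum>m<n. wronskian_mat n b (h z) $$ (k, m) * T $$ (m, j)))"
      using ij T carrier_matD[OF W[of b "h z"]]
      by (intro sum.cong refl) (simp add: scalar_prod_def atLeast0LessThan)
    finally show "wronskian_mat n a z $$ (i, j) = (C * (wronskian_mat n b (h z) * T)) $$ (i, j)"
      using entry[OF ij] ij by (simp add: sum_distrib_left wronskian_mat_def[of n a])
  qed (use T in \<open>auto simp: C_def wronskian_mat_def\<close>)
  then have "Determinant.det (wronskian_mat n a z) =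
      Determinant.det C * (Determinant.det (wronskian_mat n b (h z)) * Determinant.det T)"
    using det_mult[OF C mult_carrier_mat[OF W T]] det_mult[OF W T] by simp
  also have "Determinant.det C = prod_list (diag_mat C)"
    by (rule det_lower_triangular[of n]) (use c(1) z in \<open>auto simp: C_def\<close>)
  also have "\<dots> = (\<Prod>i<n. l z * deriv h z ^ i)"
    unfolding prod_list_diag_prod atLeast0LessThan
    by (rule prod.cong) (use c(2) z in \<open>auto simp: C_def\<close>)
  finally show ?thesis by (simp add: mult_ac)
qed


section \<open>Charts and meromorphic functions on a Riemann surface\<close>

text \<open>Continuity gives the limit, and injectivity keeps punctured neighbourhoods punctured. It
  is applied to a chart and to its inverse.\<close>

lemma filterlim_at_inj_on:
  fixes f :: "'a::t2_space \<Rightarrow> 'b::t2_space"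
  assumes "open S" "continuous_on S f" "inj_on f S" "x \<in> S"
  shows "filterlim f (at (f x)) (at x)"
  unfolding filterlim_at
proof
  show "f \<midarrow>x\<rightarrow> f x"
    using assms(2,4) unfolding continuous_on_eq_continuous_at[OF assms(1)] by (intro isContD) simp
  have "\<forall>\<^sub>F y in at x. y \<in> S - {x}"
    using assms by (intro eventually_at_in_open)
  then show "\<forall>\<^sub>F y in at x. f y \<in> UNIV \<and> f y \<noteq> f x"
    by eventually_elim (use assms(4) in \<open>simp add: inj_on_eq_iff[OF assms(3)]\<close>)
qed

text \<open>In a T1 space N - {x} is open, so a property valid on it also holds near each of its
  points. Hence the points around which \<open>P\<close> holds form an open set.\<close>

lemma eventually_at_imp_open_eventually_at:
  fixes x :: "'a::t1_space"
  assumes "\<forall>\<^sub>F y in at x. P y"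
  obtains N where "open N" "x \<in> N" "\<And>y. y \<in> N \<Longrightarrow> \<forall>\<^sub>F z in at y. P z"
proof -
  obtain N where N: "open N" "x \<in> N" "\<And>y. y \<in> N \<Longrightarrow> y \<noteq> x \<Longrightarrow> P y"
    using assms unfolding eventually_at_topological by auto
  have "\<forall>\<^sub>F z in at y. P z" if "y \<in> N" for y
  proof (cases "y = x")
    case False
    have "open (N - {x})" using N(1) by (simp add: open_Diff)
    then have "\<forall>\<^sub>F z in at y. z \<in> N - {x}"
      using False that by (intro eventually_at_in_open') simp_all
    then show ?thesis by eventually_elim (simp add: N(3))
  qed (use assms in simp)
  then show ?thesis by (rule that[OF N(1,2)])
qed

text \<open>The topological half of the identity principle: the points around which \<open>P\<close>
  holds and those around which it fails form two open sets. They cover the space by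
  \<open>dichotomy\<close> and are disjoint because no point is isolated. Analysis enters only
  through \<open>dichotomy\<close>.\<close>

lemma connected_eventually_at:
  fixes P :: "'a::t1_space \<Rightarrow> bool"
  assumes conn: "connected (UNIV :: 'a set)" and perfect: "\<And>x::'a. at x \<noteq> bot"
    and dichotomy: "\<And>x. (\<forall>\<^sub>F y in at x. P y) \<or> (\<forall>\<^sub>F y in at x. \<not> P y)"
    and ex: "\<exists>\<^sub>F y in at x0. P y"
  shows "\<forall>\<^sub>F y in at x. P y"
proof (rule ccontr)
  define A B where "A = {x. \<forall>\<^sub>F y in at x. P y}" and "B = {x. \<forall>\<^sub>F y in at x. \<not> P y}"
  assume "\<not> (\<forall>\<^sub>F y in at x. P y)"
  then have "x \<in> B" using dichotomy by (auto simp: B_def)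
  have "x0 \<notin> B" using ex by (auto simp: B_def frequently_def)
  then have "x0 \<in> A" using dichotomy[of x0] by (auto simp: A_def B_def)
  have "open {x. \<forall>\<^sub>F y in at x. Q y}" for Q :: "'a \<Rightarrow> bool"
  proof (subst open_subopen, intro ballI)
    fix x assume "x \<in> {x. \<forall>\<^sub>F y in at x. Q y}"
    then have "\<forall>\<^sub>F y in at x. Q y" by simp
    then obtain N where "open N" "x \<in> N" "\<And>y. y \<in> N \<Longrightarrow> \<forall>\<^sub>F z in at y. Q z"
      by (rule eventually_at_imp_open_eventually_at) (rule that)
    then show "\<exists>T. open T \<and> x \<in> T \<and> T \<subseteq> {x. \<forall>\<^sub>F y in at x. Q y}" by blast
  qed
  then have "open A" "open B" by (auto simp: A_def B_def)
  moreover have "A \<inter> B \<inter> UNIV = {}"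
  proof (rule ccontr)
    assume "A \<inter> B \<inter> UNIV \<noteq> {}"
    then obtain y where "\<forall>\<^sub>F y in at y. P y" "\<forall>\<^sub>F y in at y. \<not> P y" by (auto simp: A_def B_def)
    then have "\<forall>\<^sub>F y in at y. False" by eventually_elim simp
    then show False using perfect[of y] by simp
  qed
  moreover have "UNIV \<subseteq> A \<union> B" using dichotomy by (auto simp: A_def B_def)
  ultimately have "A \<inter> UNIV = {} \<or> B \<inter> UNIV = {}"
    by (intro connectedD[OF conn])
  then show False using \<open>x \<in> B\<close> \<open>x0 \<in> A\<close> by blast
qed

lemma meromorphic_at_dichotomy:
  assumes "f meromorphic_on {z}"
  shows "(\<forall>\<^sub>F w in at z. f w \<noteq> 0) \<or> (\<forall>\<^sub>F w in at z. f w = 0)"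
proof (cases "\<exists>\<^sub>F w in at z. f w = 0")
  case True
  have "isolated_singularity_at f z" "not_essential f z"
    using assms by (simp_all only: meromorphic_at_iff)
  from not_essential_frequently_0_imp_eventually_0[OF this True] show ?thesis ..
next
  case False
  then show ?thesis by (simp only: not_frequently simp_thms)
qed

lemma meromorphic_imp_eventually_analytic:
  assumes "f meromorphic_on {z}"
  shows "\<forall>\<^sub>F w in at z. f analytic_on {w}"
  using meromorphic_on_imp_not_islimpt_singularities[OF assms, of z]
  by (simp add: islimpt_conv_frequently_at frequently_def)

lemma filterlim_at_regular:
  assumes h: "h analytic_on {z}" and d: "deriv h z \<noteq> (0::complex)"
  shows "filterlim h (at (h z)) (at z)"
proof -
  have "isCont h z" by (rule analytic_at_imp_isCont[OF h])
  obtain A where A: "open A" "z \<in> A" "h holomorphic_on A"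
    using h unfolding analytic_at by blast
  obtain r where r: "r > 0" "inj_on h (ball z r)"
    using has_complex_derivative_locally_injective[OF A(3,2,1) d] by blast
  have "\<forall>\<^sub>F w in at z. w \<in> ball z r - {z}"
    using r by (intro eventually_at_in_open) auto
  then have "\<forall>\<^sub>F w in at z. h w \<noteq> h z"
    by eventually_elim (use r(1) in \<open>simp add: inj_on_eq_iff[OF r(2)]\<close>)
  then show ?thesis
    using \<open>isCont h z\<close> by (auto simp: filterlim_at isCont_def)
qed

text \<open>A nonzero derivative gives h - h(z) a simple zero, and composition multiplies the order
  of \<open>g\<close> by the order of that zero.\<close>

lemma zorder_compose_regular:
  assumes g: "g meromorphic_on {h z}" "\<forall>\<^sub>F w in at (h z). g w \<noteq> 0"
    and h: "h analytic_on {z}" "deriv h z \<noteq> 0"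
  shows "zorder (\<lambda>w. g (h w)) z = zorder g (h z)"
proof -
  have "(h has_field_derivative deriv h z) (at z)"
    using h(1) by (rule analytic_derivI)
  then have "((\<lambda>w. h w - h z) has_field_derivative deriv h z - 0) (at z)"
    by (intro DERIV_diff DERIV_const)
  then have "deriv (\<lambda>w. h w - h z) z = deriv h z"
    by (simp add: DERIV_imp_deriv)
  then have one: "zorder (\<lambda>w. h w - h z) z = 1"
    using h by (intro zorder_zero_eqI' analytic_on_diff analytic_on_const) simp_all
  have ne: "\<forall>\<^sub>F w in at z. h w \<noteq> h z"
    using filterlim_at_regular[OF h] by (simp add: filterlim_at)
  have "isolated_singularity_at g (h z)" "not_essential g (h z)"
    using g(1) by (simp_all only: meromorphic_at_iff)
  from zorder_compose'[OF this h(1) g(2) ne] show ?thesis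
    by (simp add: one o_def)
qed

section \<open>A single chart: inverse, restriction, punctured neighbourhoods\<close>

context
  fixes U :: "'a::t2_space set" and \<phi> :: "'a \<Rightarrow> complex"
  assumes chart: "coordinate_chart U \<phi>"
begin

lemma chart_open: "open U"
  using chart by (simp add: coordinate_chart_def)

lemma chart_inj_on: "inj_on \<phi> U"
  using chart by (auto simp: coordinate_chart_def homeomorphism_def intro: inj_on_inverseI)

lemma chart_continuous: "continuous_on U \<phi>"
  using chart by (simp add: coordinate_chart_def homeomorphism_def)

lemma chart_inv_continuous: "continuous_on (\<phi> ` U) (inv_into U \<phi>)"
  using chart by (simp add: coordinate_chart_def homeomorphism_def)

lemma chart_inv [simp]: "x \<in> U \<Longrightarrow> inv_into U \<phi> (\<phi> x) = x"
  using chart_inj_on by simp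

lemma chart_open_image:
  assumes "open W" "W \<subseteq> U" shows "open (\<phi> ` W)"
proof -
  have "\<phi> ` W = \<phi> ` U \<inter> inv_into U \<phi> -` W"
    using assms by (auto simp: image_iff)
  moreover have "open (\<phi> ` U)" using chart by (simp add: coordinate_chart_def)
  ultimately show ?thesis
    using chart_inv_continuous assms(1) by (simp add: continuous_open_preimage)
qed

lemma chart_restrict_inv:
  assumes "W \<subseteq> U" "z \<in> \<phi> ` W" shows "inv_into W \<phi> z = inv_into U \<phi> z"
  using assms chart_inj_on by (auto simp: inj_on_subset subset_iff)

lemma chart_restrict:
  assumes "open W" "W \<subseteq> U" shows "coordinate_chart W \<phi>"
  unfolding coordinate_chart_def homeomorphism_def
proof (intro conjI ballI)
  have W: "inj_on \<phi> W" using chart_inj_on assms inj_on_subset by blast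
  show "open W" "open (\<phi> ` W)" using assms chart_open_image by auto
  show "inv_into W \<phi> (\<phi> x) = x" if "x \<in> W" for x using W that by simp
  show "\<phi> ` W = \<phi> ` W" ..
  show "continuous_on W \<phi>" using chart_continuous assms continuous_on_subset by blast
  show "\<phi> (inv_into W \<phi> y) = y" if "y \<in> \<phi> ` W" for y using that by (simp add: f_inv_into_f)
  show "inv_into W \<phi> ` \<phi> ` W = W" using W by (force simp: image_iff)
  have "continuous_on (\<phi> ` W) (inv_into U \<phi>)"
    using chart_inv_continuous assms continuous_on_subset by blast
  then show "continuous_on (\<phi> ` W) (inv_into W \<phi>)"
    by (rule continuous_on_eq) (rule chart_restrict_inv[OF assms(2), symmetric])
qed

lemma filterlim_chart:
  assumes "x \<in> U" shows "filterlim \<phi> (at (\<phi> x)) (at x)"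
  by (rule filterlim_at_inj_on[OF chart_open chart_continuous chart_inj_on assms])

lemma filterlim_chart_inv:
  assumes "x \<in> U" shows "filterlim (inv_into U \<phi>) (at x) (at (\<phi> x))"
proof -
  have "open (\<phi> ` U)" using chart by (simp add: coordinate_chart_def)
  from filterlim_at_inj_on[OF this chart_inv_continuous inj_on_inv_into, of "\<phi> x"] assms
  show ?thesis by simp
qed

text \<open>The bridge between the surface, where the connectedness argument runs, and the plane,
  where meromorphic functions and their orders are studied.\<close>

lemma eventually_at_chart:
  assumes "x \<in> U"
  shows "(\<forall>\<^sub>F y in at x. P (\<phi> y)) \<longleftrightarrow> (\<forall>\<^sub>F z in at (\<phi> x). P z)"
proof
  assume "\<forall>\<^sub>F y in at x. P (\<phi> y)"
  then have "\<forall>\<^sub>F z in at (\<phi> x). P (\<phi> (inv_into U \<phi> z))"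
    using filterlim_chart_inv[OF assms] by (rule eventually_compose_filterlim)
  moreover have "\<forall>\<^sub>F z in at (\<phi> x). z \<in> \<phi> ` U"
    using assms chart by (intro eventually_at_in_open') (auto simp: coordinate_chart_def)
  ultimately show "\<forall>\<^sub>F z in at (\<phi> x). P z"
    by eventually_elim (simp add: f_inv_into_f)
next
  assume "\<forall>\<^sub>F z in at (\<phi> x). P z"
  then show "\<forall>\<^sub>F y in at x. P (\<phi> y)"
    using filterlim_chart[OF assms] by (rule eventually_compose_filterlim)
qed

lemma eventually_at_chart_inv:
  assumes "x \<in> U"
  shows "(\<forall>\<^sub>F z in at (\<phi> x). P (inv_into U \<phi> z)) \<longleftrightarrow> (\<forall>\<^sub>F y in at x. P y)"
proof -
  have "\<forall>\<^sub>F y in at x. y \<in> U"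
    using assms chart_open by (intro eventually_at_in_open')
  then have "\<forall>\<^sub>F y in at x. P (inv_into U \<phi> (\<phi> y)) = P y"
    by eventually_elim simp
  from eventually_subst[OF this] show ?thesis
    using eventually_at_chart[OF assms, of "\<lambda>z. P (inv_into U \<phi> z)"] by (simp only:)
qed

lemma at_chart_neq_bot: "x \<in> U \<Longrightarrow> at x \<noteq> bot"
  using eventually_at_chart[of x "\<lambda>_. False"] by auto

end

lemma holomorphic_chartD: "holomorphic_chart \<A> U \<phi> \<Longrightarrow> coordinate_chart U \<phi>"
  by (simp add: holomorphic_chart_def)

section \<open>The maximal atlas, functions on the surface and their orders\<close>

context riemann_surface
begin

lemma atlas_holomorphic_chart: "(U, \<phi>) \<in> \<A> \<Longrightarrow> holomorphic_chart \<A> U \<phi>"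
  unfolding holomorphic_chart_def by (intro conjI ballI charts charts_compatible)

lemma atlas_chart_around:
  obtains U \<phi> where "(U, \<phi>) \<in> \<A>" "x \<in> U"
proof -
  have "x \<in> (\<Union>(U, \<phi>)\<in>\<A>. U)" unfolding charts_cover ..
  then obtain c where "c \<in> \<A>" "x \<in> (case c of (U, \<phi>) \<Rightarrow> U)" by (rule UN_E)
  then show thesis using that by (cases c) (simp only: prod.case)
qed

lemma surface_at_neq_bot: "at (x :: 'a) \<noteq> bot"
proof -
  obtain U \<phi> where "(U, \<phi>) \<in> \<A>" "x \<in> U" by (rule atlas_chart_around)
  then show ?thesis by (rule at_chart_neq_bot[OF charts])
qed

text \<open>By definition a chart of the maximal atlas is compared only with charts in
  \<open>\<A>\<close>. Around each point the transition factors through one of those, and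
  analyticity may be checked point by point.\<close>

lemma transition_holomorphic:
  assumes "holomorphic_chart \<A> U \<phi>" "holomorphic_chart \<A> V \<chi>"
  shows "(\<chi> \<circ> inv_into U \<phi>) holomorphic_on \<phi> ` (U \<inter> V)"
proof -
  note U = holomorphic_chartD[OF assms(1)] and V = holomorphic_chartD[OF assms(2)]
  have "(\<chi> \<circ> inv_into U \<phi>) analytic_on {\<phi> x}" if x: "x \<in> U \<inter> V" for x
  proof -
    obtain U0 \<phi>0 where U0: "(U0, \<phi>0) \<in> \<A>" "x \<in> U0" by (rule atlas_chart_around)
    define W where "W = \<phi> ` (U \<inter> V \<inter> U0)"
    have "open W"
      unfolding W_def using chart_open[OF U] chart_open[OF V] chart_open[OF charts[OF U0(1)]]
      by (intro chart_open_image[OF U]) auto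
    have "compatible_charts (U, \<phi>) (U0, \<phi>0)" "compatible_charts (V, \<chi>) (U0, \<phi>0)"
      using assms U0(1) unfolding holomorphic_chart_def by blast+
    then have 1: "(\<phi>0 \<circ> inv_into U \<phi>) holomorphic_on \<phi> ` (U \<inter> U0)"
      and 2: "(\<chi> \<circ> inv_into U0 \<phi>0) holomorphic_on \<phi>0 ` (V \<inter> U0)"
      unfolding compatible_charts_def prod.case by blast+
    have 1: "(\<phi>0 \<circ> inv_into U \<phi>) holomorphic_on W"
      by (rule holomorphic_on_subset[OF 1]) (auto simp: W_def)
    have "((\<chi> \<circ> inv_into U0 \<phi>0) \<circ> (\<phi>0 \<circ> inv_into U \<phi>)) holomorphic_on W"
      by (rule holomorphic_on_compose_gen[OF 1 2]) (auto simp: W_def chart_inv[OF U])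
    then have "(\<chi> \<circ> inv_into U \<phi>) holomorphic_on W"
      by (rule holomorphic_transform) (auto simp: W_def chart_inv[OF U] chart_inv[OF charts[OF U0(1)]])
    moreover have "\<phi> x \<in> W" using x U0(2) by (auto simp: W_def)
    ultimately show ?thesis
      using \<open>open W\<close> unfolding analytic_at by blast
  qed
  then have "(\<chi> \<circ> inv_into U \<phi>) analytic_on {z}" if "z \<in> \<phi> ` (U \<inter> V)" for z
    using that by (elim imageE) (simp only:)
  then have "\<forall>z\<in>\<phi> ` (U \<inter> V). (\<chi> \<circ> inv_into U \<phi>) analytic_on {z}" ..
  then show ?thesis
    by (rule analytic_imp_holomorphic[OF analytic_on_analytic_at[THEN iffD2]])
qed

text \<open>An injective holomorphic map on an open set has no critical points.\<close>

lemma transition_analytic: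
  assumes "holomorphic_chart \<A> U \<phi>" "holomorphic_chart \<A> V \<chi>" "x \<in> U" "x \<in> V"
  shows "(\<chi> \<circ> inv_into U \<phi>) analytic_on {\<phi> x}" "deriv (\<chi> \<circ> inv_into U \<phi>) (\<phi> x) \<noteq> 0"
proof -
  note U = holomorphic_chartD[OF assms(1)] and V = holomorphic_chartD[OF assms(2)]
  have op: "open (\<phi> ` (U \<inter> V))"
    using chart_open[OF U] chart_open[OF V] by (intro chart_open_image[OF U]) auto
  note hol = transition_holomorphic[OF assms(1,2)]
  show "(\<chi> \<circ> inv_into U \<phi>) analytic_on {\<phi> x}"
    unfolding analytic_at using hol op assms(3,4) by blast
  have "inj_on (\<chi> \<circ> inv_into U \<phi>) (\<phi> ` (U \<inter> V))"
    using chart_inj_on[OF V] by (auto simp: inj_on_def chart_inv[OF U])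
  then show "deriv (\<chi> \<circ> inv_into U \<phi>) (\<phi> x) \<noteq> 0"
    using holomorphic_injective_imp_regular[OF hol op] assms(3,4) by auto
qed

text \<open>The filter is \<open>nhds\<close> because analyticity depends on the value at the point
  itself; for meromorphy and orders the consequence for \<open>at\<close> is used.\<close>

lemma eventually_transition:
  fixes f :: "'a \<Rightarrow> 'b"
  assumes "coordinate_chart U \<phi>" "coordinate_chart V \<chi>" "x \<in> U" "x \<in> V"
  shows "\<forall>\<^sub>F z in nhds (\<phi> x). (f \<circ> inv_into U \<phi>) z = (f \<circ> inv_into V \<chi>) ((\<chi> \<circ> inv_into U \<phi>) z)"
proof -
  have "open (\<phi> ` (U \<inter> V))"
    using chart_open assms by (intro chart_open_image[OF assms(1)]) auto
  then have "\<forall>\<^sub>F z in nhds (\<phi> x). z \<in> \<phi> ` (U \<inter> V)"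
    using assms by (intro eventually_nhds_in_open) auto
  then show ?thesis
    by eventually_elim (auto simp: chart_inv[OF assms(1)] chart_inv[OF assms(2)])
qed

lemma surface_holomorphic_onD:
  "surface_holomorphic_on \<A> f S \<Longrightarrow> (U, \<phi>) \<in> \<A> \<Longrightarrow> (f \<circ> inv_into U \<phi>) holomorphic_on \<phi> ` (U \<inter> S)"
  unfolding surface_holomorphic_on_def by (drule (1) bspec) (simp only: prod.case)

lemma surface_meromorphic_onD:
  "surface_meromorphic_on \<A> f S \<Longrightarrow> (U, \<phi>) \<in> \<A> \<Longrightarrow> (f \<circ> inv_into U \<phi>) meromorphic_on \<phi> ` (U \<inter> S)"
  unfolding surface_meromorphic_on_def by (drule (1) bspec) (simp only: prod.case)

text \<open>Holomorphy is tested on \<open>\<A>\<close>, while flat charts use coordinates of the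
  maximal atlas. Composing with the analytic transition to a chart of \<open>\<A>\<close> around x
  carries it over.\<close>

lemma surface_holomorphic_on_chart:
  assumes "surface_holomorphic_on \<A> f S" "open S" "holomorphic_chart \<A> U \<phi>" "x \<in> U" "x \<in> S"
  shows "(f \<circ> inv_into U \<phi>) analytic_on {\<phi> x}"
proof -
  have U: "coordinate_chart U \<phi>" using assms(3) by (rule holomorphic_chartD)
  obtain V \<chi> where V: "(V, \<chi>) \<in> \<A>" "x \<in> V" by (rule atlas_chart_around)
  have "open (\<chi> ` (V \<inter> S))"
    using chart_open[OF charts[OF V(1)]] assms(2) by (intro chart_open_image[OF charts[OF V(1)]]) auto
  moreover have "(f \<circ> inv_into V \<chi>) holomorphic_on \<chi> ` (V \<inter> S)"
    by (rule surface_holomorphic_onD[OF assms(1) V(1)])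
  moreover have "\<chi> x \<in> \<chi> ` (V \<inter> S)"
    using V(2) assms(5) by blast
  ultimately have "(f \<circ> inv_into V \<chi>) analytic_on {\<chi> x}"
    unfolding analytic_at by (intro exI conjI)
  then have "(f \<circ> inv_into V \<chi>) analytic_on (\<chi> \<circ> inv_into U \<phi>) ` {\<phi> x}"
    by (simp add: chart_inv[OF U assms(4)])
  from analytic_on_compose[OF transition_analytic(1)[OF assms(3) atlas_holomorphic_chart[OF V(1)]
      assms(4) V(2)] this]
  have *: "((f \<circ> inv_into V \<chi>) \<circ> (\<chi> \<circ> inv_into U \<phi>)) analytic_on {\<phi> x}" .
  have "\<forall>\<^sub>F z in nhds (\<phi> x).
      (f \<circ> inv_into U \<phi>) z = ((f \<circ> inv_into V \<chi>) \<circ> (\<chi> \<circ> inv_into U \<phi>)) z"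
    using eventually_transition[OF U charts[OF V(1)] assms(4) V(2), of f] by (simp only: o_apply)
  from analytic_at_cong[OF this refl] * show ?thesis by (rule iffD2)
qed

lemma surface_meromorphic_on_chart:
  assumes "surface_meromorphic_on \<A> f S" "holomorphic_chart \<A> U \<phi>" "x \<in> U" "x \<in> S"
  shows "(f \<circ> inv_into U \<phi>) meromorphic_on {\<phi> x}"
proof -
  have U: "coordinate_chart U \<phi>" using assms(2) by (rule holomorphic_chartD)
  obtain V \<chi> where V: "(V, \<chi>) \<in> \<A>" "x \<in> V" by (rule atlas_chart_around)
  have "(f \<circ> inv_into V \<chi>) meromorphic_on \<chi> ` (V \<inter> S)"
    by (rule surface_meromorphic_onD[OF assms(1) V(1)])
  then have *: "(\<lambda>z. (f \<circ> inv_into V \<chi>) ((\<chi> \<circ> inv_into U \<phi>) z)) meromorphic_on {\<phi> x}"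
    using transition_analytic(1)[OF assms(2) atlas_holomorphic_chart[OF V(1)] assms(3) V(2)]
    by (rule meromorphic_on_compose) (use V(2) assms(4) in \<open>simp add: chart_inv[OF U assms(3)]\<close>)
  have "\<forall>\<^sub>F z in at (\<phi> x).
      (f \<circ> inv_into U \<phi>) z = (f \<circ> inv_into V \<chi>) ((\<chi> \<circ> inv_into U \<phi>) z)"
    using eventually_transition[OF U charts[OF V(1)] assms(3) V(2), of f]
    by (simp only: eventually_nhds_conv_at)
  then have "(f \<circ> inv_into U \<phi>) meromorphic_on {\<phi> x} \<longleftrightarrow>
      (\<lambda>z. (f \<circ> inv_into V \<chi>) ((\<chi> \<circ> inv_into U \<phi>) z)) meromorphic_on {\<phi> x}"
    by (intro meromorphic_on_cong refl) (simp only: singleton_iff)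
  from this * show ?thesis by (rule iffD2)
qed

lemma zorder_surface_chart:
  assumes "surface_meromorphic_on \<A> f S" "x \<in> S" "\<forall>\<^sub>F y in at x. f y \<noteq> 0"
    and U: "(U, \<phi>) \<in> \<A>" "x \<in> U" and V: "(V, \<chi>) \<in> \<A>" "x \<in> V"
  shows "zorder (f \<circ> inv_into U \<phi>) (\<phi> x) = zorder (f \<circ> inv_into V \<chi>) (\<chi> x)"
proof -
  note cU = charts[OF U(1)] and cV = charts[OF V(1)]
  note hU = atlas_holomorphic_chart[OF U(1)] and hV = atlas_holomorphic_chart[OF V(1)]
  have x: "(\<chi> \<circ> inv_into U \<phi>) (\<phi> x) = \<chi> x" by (simp add: chart_inv[OF cU U(2)])
  have "\<forall>\<^sub>F z in at (\<chi> x). f (inv_into V \<chi> z) \<noteq> 0"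
    using assms(3) by (rule eventually_at_chart_inv[OF cV V(2), THEN iffD2])
  then have e: "\<forall>\<^sub>F z in at ((\<chi> \<circ> inv_into U \<phi>) (\<phi> x)). (f \<circ> inv_into V \<chi>) z \<noteq> 0"
    unfolding x by (simp only: o_apply)
  have m: "(f \<circ> inv_into V \<chi>) meromorphic_on {(\<chi> \<circ> inv_into U \<phi>) (\<phi> x)}"
    using surface_meromorphic_on_chart[OF assms(1) hV V(2) assms(2)] by (simp only: x)
  have *: "zorder (\<lambda>z. (f \<circ> inv_into V \<chi>) ((\<chi> \<circ> inv_into U \<phi>) z)) (\<phi> x) =
      zorder (f \<circ> inv_into V \<chi>) (\<chi> x)"
    by (rule zorder_compose_regular[OF m e transition_analytic[OF hU hV U(2) V(2)], unfolded x])
  have "\<forall>\<^sub>F z in at (\<phi> x).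
      (f \<circ> inv_into U \<phi>) z = (f \<circ> inv_into V \<chi>) ((\<chi> \<circ> inv_into U \<phi>) z)"
    using eventually_transition[OF cU cV U(2) V(2), of f] by (simp only: eventually_nhds_conv_at)
  from zorder_cong[OF this refl] * show ?thesis by (rule trans)
qed

text \<open>All charts around x give the same order by \<open>zorder_surface_chart\<close>, and the
  value is unique because \<open>(U, \<phi>)\<close> is one of the charts tested.\<close>

lemma surface_order_eq:
  assumes "surface_meromorphic_on \<A> f UNIV" "\<forall>\<^sub>F y in at x. f y \<noteq> 0" "(U, \<phi>) \<in> \<A>" "x \<in> U"
  shows "surface_order \<A> f x = zorder (f \<circ> inv_into U \<phi>) (\<phi> x)"
  unfolding surface_order_def
proof (rule the_equality)
  have "zorder (f \<circ> inv_into V \<chi>) (\<chi> x) = zorder (f \<circ> inv_into U \<phi>) (\<phi> x)"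
    if "(V, \<chi>) \<in> \<A>" "x \<in> V" for V \<chi>
    by (rule zorder_surface_chart[OF assms(1) UNIV_I assms(2) that assms(3,4)])
  then show "\<forall>(V, \<chi>)\<in>\<A>. x \<in> V \<longrightarrow>
      zorder (f \<circ> inv_into V \<chi>) (\<chi> x) = zorder (f \<circ> inv_into U \<phi>) (\<phi> x)"
    by auto
  show "k = zorder (f \<circ> inv_into U \<phi>) (\<phi> x)"
    if "\<forall>(V, \<chi>)\<in>\<A>. x \<in> V \<longrightarrow> zorder (f \<circ> inv_into V \<chi>) (\<chi> x) = k" for k
    using bspec[OF that assms(3)] assms(4) by (simp only: prod.case simp_thms)
qed

text \<open>The second hypothesis speaks of a single point; the local dichotomy and connectedness
  spread it over the surface.\<close>

lemma surface_meromorphic_nonzero: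
  assumes "surface_meromorphic_on \<A> f UNIV" "not_identically_zero_on f UNIV"
  shows "\<forall>\<^sub>F y in at x. f y \<noteq> 0"
proof -
  obtain x0 where x0: "\<exists>\<^sub>F y in at x0. f y \<noteq> 0"
    using assms(2) by (auto simp: not_identically_zero_on_def)
  have "(\<forall>\<^sub>F y in at x. f y \<noteq> 0) \<or> (\<forall>\<^sub>F y in at x. \<not> f y \<noteq> 0)" for x
  proof -
    obtain V \<chi> where V: "(V, \<chi>) \<in> \<A>" "x \<in> V" by (rule atlas_chart_around)
    have "(f \<circ> inv_into V \<chi>) meromorphic_on {\<chi> x}"
      by (rule surface_meromorphic_on_chart[OF assms(1) atlas_holomorphic_chart]) (use V in auto)
    from meromorphic_at_dichotomy[OF this] show ?thesis
      using eventually_at_chart_inv[OF charts[OF V(1)] V(2), of "\<lambda>y. f y \<noteq> 0"]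
        eventually_at_chart_inv[OF charts[OF V(1)] V(2), of "\<lambda>y. f y = 0"]
      by (simp only: o_apply not_not)
  qed
  then show ?thesis
    by (rule connected_eventually_at[OF connected_surface surface_at_neq_bot _ x0])
qed

text \<open>The product of the two functions realises the sum; both factors are nonzero near every
  point, hence so is the product. This closure later turns a principal difference into an inclusion
  of cosets.\<close>

lemma principal_divisors_add:
  assumes "D \<in> principal_divisors \<A>" "E \<in> principal_divisors \<A>"
  shows "(\<lambda>x. D x + E x) \<in> principal_divisors \<A>"
proof -
  from assms(1) obtain f where
    f: "D = surface_order \<A> f" "surface_meromorphic_on \<A> f UNIV" "not_identically_zero_on f UNIV"
    unfolding principal_divisors_def mem_Collect_eq by (elim exE conjE)
  from assms(2) obtain g where
    g: "E = surface_order \<A> g" "surface_meromorphic_on \<A> g UNIV" "not_identically_zero_on g UNIV"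
    unfolding principal_divisors_def mem_Collect_eq by (elim exE conjE)
  define k where "k = (\<lambda>x. f x * g x)"
  have comp: "k \<circ> \<theta> = (\<lambda>z. (f \<circ> \<theta>) z * (g \<circ> \<theta>) z)" for \<theta> :: "complex \<Rightarrow> 'a"
    by (auto simp: k_def)
  have kmer: "surface_meromorphic_on \<A> k UNIV"
    unfolding surface_meromorphic_on_def comp
  proof (intro ballI, clarify)
    fix U \<phi> assume "(U, \<phi>) \<in> \<A>"
    then show "(\<lambda>z. (f \<circ> inv_into U \<phi>) z * (g \<circ> inv_into U \<phi>) z) meromorphic_on \<phi> ` (U \<inter> UNIV)"
      by (intro meromorphic_on_mult surface_meromorphic_onD f(2) g(2))
  qed
  have nz: "\<forall>\<^sub>F y in at x. f y \<noteq> 0" "\<forall>\<^sub>F y in at x. g y \<noteq> 0" for x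
    using surface_meromorphic_nonzero f(2,3) g(2,3) by blast+
  then have knz: "\<forall>\<^sub>F y in at x. k y \<noteq> 0" for x
    unfolding k_def using nz(1)[of x] nz(2)[of x] by eventually_elim simp
  have k: "not_identically_zero_on k UNIV"
    unfolding not_identically_zero_on_def
    using eventually_frequently[OF surface_at_neq_bot knz] by blast
  have order: "surface_order \<A> k x = D x + E x" for x
  proof -
    obtain V \<chi> where V: "(V, \<chi>) \<in> \<A>" "x \<in> V" by (rule atlas_chart_around)
    note mer = surface_meromorphic_on_chart[OF _ atlas_holomorphic_chart[OF V(1)] V(2) UNIV_I]
    have ev: "\<forall>\<^sub>F z in at (\<chi> x). (u \<circ> inv_into V \<chi>) z \<noteq> 0" if "\<forall>\<^sub>F y in at x. u y \<noteq> 0" for u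
      using eventually_at_chart_inv[OF charts[OF V(1)] V(2), of "\<lambda>y. u y \<noteq> 0"] that
      by (simp only: o_apply)
    have "zorder (k \<circ> inv_into V \<chi>) (\<chi> x) =
        zorder (f \<circ> inv_into V \<chi>) (\<chi> x) + zorder (g \<circ> inv_into V \<chi>) (\<chi> x)"
      unfolding comp
      by (intro zorder_mult mer f(2) g(2) eventually_frequently ev nz at_neq_bot)
    then show ?thesis
      using surface_order_eq[OF f(2) nz(1) V] surface_order_eq[OF g(2) nz(2) V]
        surface_order_eq[OF kmer knz V] f(1) g(1) by (simp only:)
  qed
  have "(\<lambda>x. D x + E x) = surface_order \<A> k"
    using order by (intro ext) (rule sym)
  then show ?thesis
    unfolding principal_divisors_def mem_Collect_eq using kmer k by (intro exI conjI)
qed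

end


section \<open>Change of flat trivialization\<close>

lemma index_row_mult:
  assumes "M \<in> carrier_mat n n" "v \<in> carrier_vec n" "j < n"
  shows "vec_index (row_mult v M) j = (\<Sum>m<n. M $$ (m, j) * vec_index v m)"
  using assms(3) carrier_matD[OF assms(1)] carrier_vecD[OF assms(2)]
  by (simp add: row_mult_def scalar_prod_def atLeast0LessThan)

lemma row_mult_mult:
  assumes "M \<in> carrier_mat n n" "M' \<in> carrier_mat n n" "v \<in> carrier_vec n"
  shows "row_mult (row_mult v M) M' = row_mult v (M * M')"
  unfolding row_mult_def transpose_mult[OF assms(1,2)]
  by (rule assoc_mult_mat_vec[of _ n n _ n, symmetric]) (simp_all add: assms)

lemma row_mult_smult:
  assumes "M \<in> carrier_mat n n" "v \<in> carrier_vec n"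
  shows "row_mult (c \<cdot>\<^sub>v v) M = c \<cdot>\<^sub>v row_mult v M"
  unfolding row_mult_def by (rule mult_mat_vec[of _ n n]) (simp_all add: assms)

lemma row_mult_one: "v \<in> carrier_vec n \<Longrightarrow> row_mult v (1\<^sub>m n) = v"
  by (simp add: row_mult_def transpose_one)

lemma row_mult_carrier: "M \<in> carrier_mat n n \<Longrightarrow> row_mult v M \<in> carrier_vec n"
  by (simp add: row_mult_def mult_mat_vec_def)

lemma GL_mat_inverse:
  assumes "M \<in> GL_mat n"
  obtains B where "B \<in> carrier_mat n n" "M * B = 1\<^sub>m n"
proof -
  have M: "M \<in> carrier_mat n n" and "invertible_mat M" using assms by (simp_all add: GL_mat_def)
  from this(2) obtain B where B: "M * B = 1\<^sub>m (dim_row M)" "B * M = 1\<^sub>m (dim_row B)"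
    unfolding invertible_mat_def inverts_mat_def by (elim exE conjE)
  \<comment> \<open>\<open>invertible_mat\<close> does not state the size of the inverse; both
    dimensions are read off by counting columns in the two equations.\<close>
  have "dim_col B = n" using arg_cong[OF B(1), of dim_col] carrier_matD[OF M] by simp
  moreover have "dim_row B = n" using arg_cong[OF B(2), of dim_col] carrier_matD[OF M] by simp
  ultimately have "B \<in> carrier_mat n n" by (rule carrier_matI[rotated])
  moreover have "M * B = 1\<^sub>m n" using B(1) unfolding carrier_matD(1)[OF M] .
  ultimately show ?thesis by (rule that)
qed

lemma det_GL_mat_neq_0:
  assumes "M \<in> GL_mat n" shows "Determinant.det M \<noteq> 0"
proof -
  have M: "M \<in> carrier_mat n n" using assms by (simp add: GL_mat_def)
  obtain B where B: "B \<in> carrier_mat n n" "M * B = 1\<^sub>m n" by (rule GL_mat_inverse[OF assms])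
  have "Determinant.det M * Determinant.det B = 1"
    using det_mult[OF M B(1)] unfolding B(2) det_one by (rule sym)
  then show ?thesis by (metis mult_zero_left zero_neq_one)
qed

text \<open>By the Leibniz formula the determinant is a polynomial in derivatives of the components,
  and derivatives of meromorphic functions are meromorphic.\<close>

lemma section_wronskian_meromorphic:
  assumes "\<And>j. j < n \<Longrightarrow> (\<lambda>\<zeta>. vec_index ((\<psi> \<circ> s \<circ> inv_into U \<phi>) \<zeta>) j) meromorphic_on A"
  shows "section_wronskian n s U \<phi> \<psi> meromorphic_on A"
proof -
  have "section_wronskian n s U \<phi> \<psi> = (\<lambda>z. \<Sum>\<pi> | \<pi> permutes {0..<n}. signof \<pi> *
      (\<Prod>i = 0..<n. wronskian_mat n (\<psi> \<circ> s \<circ> inv_into U \<phi>) z $$ (i, \<pi> i)))"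
    unfolding section_wronskian_def
    by (rule ext, rule det_def') (simp add: wronskian_mat_def)
  moreover have "(\<lambda>z. \<Sum>\<pi> | \<pi> permutes {0..<n}. signof \<pi> *
      (\<Prod>i = 0..<n. wronskian_mat n (\<psi> \<circ> s \<circ> inv_into U \<phi>) z $$ (i, \<pi> i))) meromorphic_on A"
  proof (intro meromorphic_on_sum meromorphic_on_mult meromorphic_on_const meromorphic_on_prod)
    fix \<pi> i assume "\<pi> \<in> {\<pi>. \<pi> permutes {0..<n}}" and i: "i \<in> {0..<n}"
    then have "\<pi> permutes {0..<n}" by simp
    from permutes_in_image[OF this, of i] have \<pi>: "\<pi> i < n" using i by simp
    then have "(\<lambda>z. wronskian_mat n (\<psi> \<circ> s \<circ> inv_into U \<phi>) z $$ (i, \<pi> i)) =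
        (deriv ^^ i) (\<lambda>\<zeta>. vec_index ((\<psi> \<circ> s \<circ> inv_into U \<phi>) \<zeta>) (\<pi> i))"
      using i by (simp add: wronskian_mat_def)
    then show "(\<lambda>z. wronskian_mat n (\<psi> \<circ> s \<circ> inv_into U \<phi>) z $$ (i, \<pi> i)) meromorphic_on A"
      using meromorphic_on_higher_deriv[OF assms[OF \<pi>], of i] by (simp only:)
  qed
  ultimately show ?thesis by (simp only:)
qed

context riemann_surface
begin

lemma holomorphic_chart_restrict:
  assumes "holomorphic_chart \<A> U \<phi>" "open W" "W \<subseteq> U"
  shows "holomorphic_chart \<A> W \<phi>"
  unfolding holomorphic_chart_def
proof (intro conjI ballI)
  note U = holomorphic_chartD[OF assms(1)]
  show "coordinate_chart W \<phi>" by (rule chart_restrict[OF U assms(2,3)])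
  fix c assume c: "c \<in> \<A>"
  obtain V \<chi> where [simp]: "c = (V, \<chi>)" by (cases c)
  have "compatible_charts (U, \<phi>) (V, \<chi>)" using assms(1) c unfolding holomorphic_chart_def by simp
  then have 1: "(\<chi> \<circ> inv_into U \<phi>) holomorphic_on \<phi> ` (U \<inter> V)"
    and 2: "(\<phi> \<circ> inv_into V \<chi>) holomorphic_on \<chi> ` (U \<inter> V)"
    unfolding compatible_charts_def prod.case by blast+
  have "(\<chi> \<circ> inv_into U \<phi>) holomorphic_on \<phi> ` (W \<inter> V)"
    by (rule holomorphic_on_subset[OF 1]) (use assms(3) in blast)
  then have "(\<chi> \<circ> inv_into W \<phi>) holomorphic_on \<phi> ` (W \<inter> V)"
  proof (rule holomorphic_transform)
    fix z assume "z \<in> \<phi> ` (W \<inter> V)"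
    then have "z \<in> \<phi> ` W" by blast
    then show "(\<chi> \<circ> inv_into U \<phi>) z = (\<chi> \<circ> inv_into W \<phi>) z"
      by (simp only: o_apply chart_restrict_inv[OF U assms(3)])
  qed
  moreover have "(\<phi> \<circ> inv_into V \<chi>) holomorphic_on \<chi> ` (W \<inter> V)"
    by (rule holomorphic_on_subset[OF 2]) (use assms(3) in blast)
  ultimately show "compatible_charts (W, \<phi>) c" by (simp add: compatible_charts_def)
qed

lemma surface_holomorphic_on_subset:
  assumes "surface_holomorphic_on \<A> f S" "T \<subseteq> S"
  shows "surface_holomorphic_on \<A> f T"
  unfolding surface_holomorphic_on_def
proof (intro ballI, clarify)
  fix U \<phi> assume "(U, \<phi>) \<in> \<A>"
  from surface_holomorphic_onD[OF assms(1) this]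
  show "(f \<circ> inv_into U \<phi>) holomorphic_on \<phi> ` (U \<inter> T)"
    by (rule holomorphic_on_subset) (use assms(2) in blast)
qed

lemma nonvanishing_holomorphic_on_subset:
  "nonvanishing_holomorphic_on \<A> l S \<Longrightarrow> T \<subseteq> S \<Longrightarrow> nonvanishing_holomorphic_on \<A> l T"
  unfolding nonvanishing_holomorphic_on_def by (meson surface_holomorphic_on_subset subsetD)

lemma nonvanishing_holomorphic_on_divide:
  assumes f: "nonvanishing_holomorphic_on \<A> f S" and g: "nonvanishing_holomorphic_on \<A> g S"
  shows "nonvanishing_holomorphic_on \<A> (\<lambda>x. f x / g x) S"
  unfolding nonvanishing_holomorphic_on_def surface_holomorphic_on_def
proof (intro conjI ballI, clarify)
  fix U \<phi> assume U: "(U, \<phi>) \<in> \<A>"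
  have "(\<lambda>z. (f \<circ> inv_into U \<phi>) z / (g \<circ> inv_into U \<phi>) z) holomorphic_on \<phi> ` (U \<inter> S)"
  proof (rule holomorphic_on_divide)
    show "(f \<circ> inv_into U \<phi>) holomorphic_on \<phi> ` (U \<inter> S)" "(g \<circ> inv_into U \<phi>) holomorphic_on \<phi> ` (U \<inter> S)"
      using f g surface_holomorphic_onD[OF _ U] unfolding nonvanishing_holomorphic_on_def by blast+
    fix z assume "z \<in> \<phi> ` (U \<inter> S)"
    then obtain x where "z = \<phi> x" "x \<in> U" "x \<in> S" by blast
    then show "(g \<circ> inv_into U \<phi>) z \<noteq> 0"
      using g by (simp add: nonvanishing_holomorphic_on_def chart_inv[OF charts[OF U]])
  qed
  then show "((\<lambda>x. f x / g x) \<circ> inv_into U \<phi>) holomorphic_on \<phi> ` (U \<inter> S)"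
    by (simp only: o_def)
next
  fix x assume "x \<in> S"
  then show "f x / g x \<noteq> 0" using f g by (simp add: nonvanishing_holomorphic_on_def)
qed

end

lemma trivialization_overD:
  assumes "trivialization_over n p V \<psi>"
  shows "open V" "p e \<in> V \<Longrightarrow> \<psi> e \<in> carrier_vec n"
proof -
  show "open V" using assms unfolding trivialization_over_def by (rule conjunct1)
  assume "p e \<in> V"
  then have "bij_betw \<psi> (p -` {p e}) (carrier_vec n)"
    using assms unfolding trivialization_over_def by blast
  then show "\<psi> e \<in> carrier_vec n" by (rule bij_betw_apply) simp
qed

context projectively_flat_bundle
begin

lemma flat_frame_around:
  obtains V \<chi> where "(V, \<chi>) \<in> \<F>" "x \<in> V"
proof -
  have "x \<in> (\<Union>(V, \<chi>)\<in>\<F>. V)" unfolding flat_cover ..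
  then obtain c where "c \<in> \<F>" "x \<in> (case c of (V, \<chi>) \<Rightarrow> V)" by (rule UN_E)
  then show thesis using that by (cases c) (simp only: prod.case)
qed

lemma frame_around:
  obtains V \<chi> where "(V, \<chi>) \<in> \<B>" "x \<in> V"
proof -
  have "x \<in> (\<Union>(V, \<chi>)\<in>\<B>. V)" unfolding trivializations_cover ..
  then obtain c where "c \<in> \<B>" "x \<in> (case c of (V, \<chi>) \<Rightarrow> V)" by (rule UN_E)
  then show thesis using that by (cases c) (simp only: prod.case)
qed

lemma flat_trivialization_restrict:
  assumes V: "(V, \<chi>) \<in> \<F>" and W: "open W" "W \<subseteq> V"
  shows "flat_trivialization \<A> n p \<F> W \<chi>"
  unfolding flat_trivialization_def
proof (intro conjI ballI, goal_cases)
  case 1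
  show ?case using flat_trivializations[OF V] W by (auto simp: trivialization_over_def)
next
  case (2 c)
  obtain V' \<chi>' where c: "c = (V', \<chi>')" by (cases c)
  with 2 have "(V', \<chi>') \<in> \<F>" by simp
  from flat_transitions[OF V this] obtain l T where T: "T \<in> GL_mat n"
    and l: "nonvanishing_holomorphic_on \<A> l (V \<inter> V')"
    and e: "\<forall>e. p e \<in> V \<inter> V' \<longrightarrow> \<chi> e = l (p e) \<cdot>\<^sub>v row_mult (\<chi>' e) T"
    by blast
  have "nonvanishing_holomorphic_on \<A> l (W \<inter> V')"
    by (rule nonvanishing_holomorphic_on_subset[OF l]) (use W in blast)
  \<comment> \<open>The structure supplies one matrix per overlap; it serves as a constant function
    of the point.\<close>
  moreover have "\<forall>x\<in>W \<inter> V'. T \<in> GL_mat n \<and> (\<exists>N. open N \<and> x \<in> N \<and> (\<forall>y\<in>N \<inter> W \<inter> V'. T = T))"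
    using T open_UNIV by blast
  moreover have "\<forall>e. p e \<in> W \<inter> V' \<longrightarrow> \<chi> e = l (p e) \<cdot>\<^sub>v row_mult (\<chi>' e) T"
    using e W(2) by blast
  ultimately show ?case
    unfolding c prod.case by (intro exI[of _ l] exI[of _ "\<lambda>_. T"] conjI)
qed

text \<open>The domain must be connected and lie in both a chart and a flat trivialization, so it is
  cut out by a small disc in the coordinate. The coordinate of the given chart of
  \<open>\<A>\<close> is kept: orders on the surface and orders of Wronskians can then be compared
  without any change of variable.\<close>

lemma flat_chart_exists:
  assumes U: "(U, \<phi>) \<in> \<A>" "x \<in> U"
  obtains W \<psi> where "flat_chart \<A> n p \<F> W \<phi> \<psi>" "x \<in> W" "W \<subseteq> U"
proof -
  obtain V \<psi> where V: "(V, \<psi>) \<in> \<F>" "x \<in> V" by (rule flat_frame_around)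
  note cU = charts[OF U(1)]
  have oV: "open V" by (rule trivialization_overD(1)[OF flat_trivializations[OF V(1)]])
  have "open (\<phi> ` (U \<inter> V))"
    by (rule chart_open_image[OF cU open_Int[OF chart_open[OF cU] oV]]) simp
  moreover have "\<phi> x \<in> \<phi> ` (U \<inter> V)" using U V by blast
  ultimately obtain r where r: "r > 0" "ball (\<phi> x) r \<subseteq> \<phi> ` (U \<inter> V)"
    by (rule openE)
  define W where "W = U \<inter> \<phi> -` ball (\<phi> x) r"
  have W: "open W" "W \<subseteq> U"
    unfolding W_def using continuous_open_preimage[OF chart_continuous[OF cU] chart_open[OF cU] open_ball]
    by simp_all
  have xW: "x \<in> W" using U r by (simp add: W_def)
  have WV: "W \<subseteq> V"
  proof
    fix y assume y: "y \<in> W"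
    then have "\<phi> y \<in> \<phi> ` (U \<inter> V)" using r(2) by (auto simp: W_def)
    then obtain y' where "y' \<in> U" "y' \<in> V" "\<phi> y = \<phi> y'" by blast
    moreover have "y \<in> U" using y by (simp add: W_def)
    ultimately show "y \<in> V" using inj_onD[OF chart_inj_on[OF cU], of y y'] by simp
  qed
  \<comment> \<open>Connectedness of \<open>W\<close>: it is the image of a disc under the
    continuous inverse coordinate.\<close>
  have "W = inv_into U \<phi> ` ball (\<phi> x) r"
  proof (intro equalityI subsetI)
    fix y assume "y \<in> W"
    then have "y = inv_into U \<phi> (\<phi> y)" "\<phi> y \<in> ball (\<phi> x) r" by (simp_all add: W_def chart_inv[OF cU])
    then show "y \<in> inv_into U \<phi> ` ball (\<phi> x) r" by (rule image_eqI)
  next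
    fix y assume "y \<in> inv_into U \<phi> ` ball (\<phi> x) r"
    then obtain z where z: "z \<in> ball (\<phi> x) r" "y = inv_into U \<phi> z" by blast
    then have "z \<in> \<phi> ` U" using r(2) by blast
    with z show "y \<in> W" by (simp add: W_def inv_into_into f_inv_into_f)
  qed
  moreover have "continuous_on (ball (\<phi> x) r) (inv_into U \<phi>)"
    by (rule continuous_on_subset[OF chart_inv_continuous[OF cU]]) (use r(2) in blast)
  ultimately have "connected W"
    using connected_continuous_image[of "ball (\<phi> x) r" "inv_into U \<phi>"] by simp
  then have "flat_chart \<A> n p \<F> W \<phi> \<psi>"
    unfolding flat_chart_def
    using holomorphic_chart_restrict[OF atlas_holomorphic_chart[OF U(1)] W]
      flat_trivialization_restrict[OF V(1) W(1) WV] by (intro conjI)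
  then show thesis using xW W(2) by (rule that)
qed

lemma flat_chart_around:
  obtains U \<phi> \<psi> where "flat_chart \<A> n p \<F> U \<phi> \<psi>" "x \<in> U"
proof -
  obtain U \<phi> where U: "(U, \<phi>) \<in> \<A>" "x \<in> U" by (rule atlas_chart_around)
  obtain W \<psi> where "flat_chart \<A> n p \<F> W \<phi> \<psi>" "x \<in> W" "W \<subseteq> U" by (rule flat_chart_exists[OF U])
  then show thesis by (intro that)
qed

text \<open>The matrix is only locally constant on the overlap; on a smaller neighbourhood it
  becomes a single matrix, which derivatives leave untouched.\<close>

lemma flat_trivialization_local:
  assumes "flat_trivialization \<A> n p \<F> U \<psi>" "(V, \<chi>) \<in> \<F>" "x \<in> U" "x \<in> V"
  obtains N l T where "open N" "x \<in> N" "N \<subseteq> U" "N \<subseteq> V" "T \<in> GL_mat n"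
    "nonvanishing_holomorphic_on \<A> l N"
    "\<And>e. p e \<in> N \<Longrightarrow> \<psi> e = l (p e) \<cdot>\<^sub>v row_mult (\<chi> e) T"
proof -
  have oU: "open U"
    using assms(1) unfolding flat_trivialization_def by (elim conjE) (rule trivialization_overD(1))
  have oV: "open V" by (rule trivialization_overD(1)[OF flat_trivializations[OF assms(2)]])
  have "\<forall>(V', \<psi>')\<in>\<F>. \<exists>l T. nonvanishing_holomorphic_on \<A> l (U \<inter> V') \<and>
      (\<forall>x\<in>U \<inter> V'. T x \<in> GL_mat n \<and>
        (\<exists>N. open N \<and> x \<in> N \<and> (\<forall>y\<in>N \<inter> U \<inter> V'. T y = T x))) \<and>
      (\<forall>e. p e \<in> U \<inter> V' \<longrightarrow> \<psi> e = l (p e) \<cdot>\<^sub>v row_mult (\<psi>' e) (T (p e)))"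
    using assms(1) unfolding flat_trivialization_def by (rule conjunct2)
  from bspec[OF this assms(2)] obtain l T where l: "nonvanishing_holomorphic_on \<A> l (U \<inter> V)"
    and T: "\<forall>x\<in>U \<inter> V. T x \<in> GL_mat n \<and>
        (\<exists>N. open N \<and> x \<in> N \<and> (\<forall>y\<in>N \<inter> U \<inter> V. T y = T x))"
    and e: "\<forall>e. p e \<in> U \<inter> V \<longrightarrow> \<psi> e = l (p e) \<cdot>\<^sub>v row_mult (\<chi> e) (T (p e))"
    unfolding prod.case by (elim exE conjE)
  have "x \<in> U \<inter> V" using assms(3,4) by simp
  from bspec[OF T this] obtain N where N: "open N" "x \<in> N" "\<And>y. y \<in> N \<inter> U \<inter> V \<Longrightarrow> T y = T x"
    and Tx: "T x \<in> GL_mat n"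
    by (elim conjE exE) (rule that, assumption+, erule bspec, assumption+)
  show thesis
  proof (rule that[of "N \<inter> U \<inter> V" "T x" l])
    show "open (N \<inter> U \<inter> V)" using N oU oV by (intro open_Int)
    show "x \<in> N \<inter> U \<inter> V" using N assms by blast
    show "nonvanishing_holomorphic_on \<A> l (N \<inter> U \<inter> V)"
      by (rule nonvanishing_holomorphic_on_subset[OF l]) blast
    show "\<psi> e' = l (p e') \<cdot>\<^sub>v row_mult (\<chi> e') (T x)" if "p e' \<in> N \<inter> U \<inter> V" for e'
    proof -
      have "p e' \<in> U \<inter> V" using that by simp
      with e have "\<psi> e' = l (p e') \<cdot>\<^sub>v row_mult (\<chi> e') (T (p e'))" by simp
      then show ?thesis by (simp only: N(3)[OF that])
    qed
  qed (use Tx in auto)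
qed

text \<open>Admissible trivializations are compared only with \<open>\<F>\<close>, so both are
  expressed in one frame of \<open>\<F>\<close> around x. From \<psi> = l1 \<chi> T1 and \<psi>' =
  l2 \<chi> T2 it follows that \<psi> = (l1 / l2) \<psi>' S T1, where \<open>S\<close> is the
  inverse of \<open>T2\<close>.\<close>

lemma flat_trivialization_change:
  assumes U: "flat_trivialization \<A> n p \<F> U \<psi>" "x \<in> U"
    and U': "flat_trivialization \<A> n p \<F> U' \<psi>'" "x \<in> U'"
  obtains N l T where "open N" "x \<in> N" "N \<subseteq> U" "N \<subseteq> U'"
    "T \<in> carrier_mat n n" "Determinant.det T \<noteq> 0" "nonvanishing_holomorphic_on \<A> l N"
    "\<And>e j. p e \<in> N \<Longrightarrow> j < n \<Longrightarrow>
      vec_index (\<psi> e) j = l (p e) * (\<Sum>m<n. T $$ (m, j) * vec_index (\<psi>' e) m)"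
proof -
  obtain V \<chi> where V: "(V, \<chi>) \<in> \<F>" "x \<in> V" by (rule flat_frame_around)
  obtain N1 l1 T1 where N1: "open N1" "x \<in> N1" "N1 \<subseteq> U" "N1 \<subseteq> V" and T1: "T1 \<in> GL_mat n"
    and l1: "nonvanishing_holomorphic_on \<A> l1 N1"
    and e1: "\<And>e. p e \<in> N1 \<Longrightarrow> \<psi> e = l1 (p e) \<cdot>\<^sub>v row_mult (\<chi> e) T1"
    by (rule flat_trivialization_local[OF U(1) V(1) U(2) V(2)]) (rule that)
  obtain N2 l2 T2 where N2: "open N2" "x \<in> N2" "N2 \<subseteq> U'" "N2 \<subseteq> V" and T2: "T2 \<in> GL_mat n"
    and l2: "nonvanishing_holomorphic_on \<A> l2 N2"
    and e2: "\<And>e. p e \<in> N2 \<Longrightarrow> \<psi>' e = l2 (p e) \<cdot>\<^sub>v row_mult (\<chi> e) T2"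
    by (rule flat_trivialization_local[OF U'(1) V(1) U'(2) V(2)]) (rule that)
  obtain S where S: "S \<in> carrier_mat n n" "T2 * S = 1\<^sub>m n" by (rule GL_mat_inverse[OF T2])
  have T12: "T1 \<in> carrier_mat n n" "T2 \<in> carrier_mat n n" using T1 T2 by (simp_all add: GL_mat_def)
  have ST: "S * T1 \<in> carrier_mat n n" using S T12 by simp
  have dS: "Determinant.det T2 * Determinant.det S = 1"
    using det_mult[OF T12(2) S(1)] unfolding S(2) det_one by (rule sym)
  show thesis
  proof (rule that[of "N1 \<inter> N2" "S * T1" "\<lambda>y. l1 y / l2 y"])
    show "open (N1 \<inter> N2)" "x \<in> N1 \<inter> N2" "N1 \<inter> N2 \<subseteq> U" "N1 \<inter> N2 \<subseteq> U'"
      using N1 N2 by (simp_all add: open_Int le_infI1 le_infI2)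
    show "S * T1 \<in> carrier_mat n n" by (rule ST)
    show "Determinant.det (S * T1) \<noteq> 0"
      unfolding det_mult[OF S(1) T12(1)] using dS det_GL_mat_neq_0[OF T1]
      by (metis mult_eq_0_iff zero_neq_one)
    show "nonvanishing_holomorphic_on \<A> (\<lambda>y. l1 y / l2 y) (N1 \<inter> N2)"
      by (intro nonvanishing_holomorphic_on_divide nonvanishing_holomorphic_on_subset[OF l1]
          nonvanishing_holomorphic_on_subset[OF l2]) simp_all
    fix e j assume e: "p e \<in> N1 \<inter> N2" and j: "j < n"
    have \<chi>: "\<chi> e \<in> carrier_vec n"
      using trivialization_overD(2)[OF flat_trivializations[OF V(1)]] e N1(4) by blast
    have \<chi>2: "row_mult (\<chi> e) T2 \<in> carrier_vec n" by (rule row_mult_carrier[OF T12(2)])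
    then have \<psi>': "\<psi>' e \<in> carrier_vec n" using e2 e by simp
    have "row_mult (\<psi>' e) S = l2 (p e) \<cdot>\<^sub>v row_mult (row_mult (\<chi> e) T2) S"
      using e2 e by (simp add: row_mult_smult[OF S(1) \<chi>2])
    also have "\<dots> = l2 (p e) \<cdot>\<^sub>v \<chi> e"
      by (simp only: row_mult_mult[OF T12(2) S(1) \<chi>] S(2) row_mult_one[OF \<chi>])
    finally have "row_mult (\<psi>' e) (S * T1) = l2 (p e) \<cdot>\<^sub>v row_mult (\<chi> e) T1"
      using row_mult_mult[OF S(1) T12(1) \<psi>'] by (simp add: row_mult_smult[OF T12(1) \<chi>])
    then have "vec_index (row_mult (\<psi>' e) (S * T1)) j = l2 (p e) * vec_index (row_mult (\<chi> e) T1) j"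
      using j carrier_vecD[OF row_mult_carrier[OF T12(1)]] by simp
    moreover have "vec_index (\<psi> e) j = l1 (p e) * vec_index (row_mult (\<chi> e) T1) j"
      using e1 e j carrier_vecD[OF row_mult_carrier[OF T12(1)]] by simp
    moreover have "l2 (p e) \<noteq> 0" using l2 e by (simp add: nonvanishing_holomorphic_on_def)
    ultimately have "vec_index (\<psi> e) j = l1 (p e) / l2 (p e) * vec_index (row_mult (\<psi>' e) (S * T1)) j"
      by simp
    then show "vec_index (\<psi> e) j =
        l1 (p e) / l2 (p e) * (\<Sum>m<n. (S * T1) $$ (m, j) * vec_index (\<psi>' e) m)"
      by (simp only: index_row_mult[OF ST \<psi>' j])
  qed
qed

end


section \<open>The divisor of a generic section\<close>

lemma flat_chartD:
  assumes "flat_chart \<A> n p \<F> U \<phi> \<psi>"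
  shows "holomorphic_chart \<A> U \<phi>" "flat_trivialization \<A> n p \<F> U \<psi>" "coordinate_chart U \<phi>" "open U"
proof -
  show h: "holomorphic_chart \<A> U \<phi>" and "flat_trivialization \<A> n p \<F> U \<psi>"
    using assms by (simp_all add: flat_chart_def)
  show "coordinate_chart U \<phi>" by (rule holomorphic_chartD[OF h])
  then show "open U" by (rule chart_open)
qed

context projectively_flat_bundle
begin

text \<open>The factor \<mu> is bound before the section, so that it cancels in quotients.
  Analyticity is asked in the second frame only, at the image of z: there the derivatives of the
  components obey the product and chain rules.\<close>

lemma wronskian_change:
  assumes c: "flat_chart \<A> n p \<F> U \<phi> \<psi>" "x \<in> U" and c': "flat_chart \<A> n p \<F> U' \<phi>' \<psi>'" "x \<in> U'"
  obtains N \<mu> where "open N" "\<phi> x \<in> N" "N \<subseteq> \<phi> ` (U \<inter> U')" "\<mu> holomorphic_on N"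
    "\<And>z. z \<in> N \<Longrightarrow> \<mu> z \<noteq> 0"
    "\<And>s z. (\<forall>y. p (s y) = y) \<Longrightarrow> z \<in> N \<Longrightarrow>
      (\<forall>m<n. (\<lambda>\<zeta>. vec_index ((\<psi>' \<circ> s \<circ> inv_into U' \<phi>') \<zeta>) m)
        analytic_on {(\<phi>' \<circ> inv_into U \<phi>) z}) \<Longrightarrow>
      section_wronskian n s U \<phi> \<psi> z =
        \<mu> z * section_wronskian n s U' \<phi>' \<psi>' ((\<phi>' \<circ> inv_into U \<phi>) z)"
proof -
  note U = flat_chartD[OF c(1)] and U' = flat_chartD[OF c'(1)]
  obtain N0 l T where N0: "open N0" "x \<in> N0" "N0 \<subseteq> U" "N0 \<subseteq> U'"
    and T: "T \<in> carrier_mat n n" "Determinant.det T \<noteq> 0"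
    and l: "nonvanishing_holomorphic_on \<A> l N0"
    and e: "\<And>e j. p e \<in> N0 \<Longrightarrow> j < n \<Longrightarrow>
      vec_index (\<psi> e) j = l (p e) * (\<Sum>m<n. T $$ (m, j) * vec_index (\<psi>' e) m)"
    by (rule flat_trivialization_change[OF U(2) c(2) U'(2) c'(2)]) (rule that)
  define N where "N = \<phi> ` N0"
  define h where "h = \<phi>' \<circ> inv_into U \<phi>"
  define L where "L = l \<circ> inv_into U \<phi>"
  define \<mu> where "\<mu> = (\<lambda>z. (\<Prod>i<n. L z * deriv h z ^ i) * Determinant.det T)"
  have N: "open N" unfolding N_def by (rule chart_open_image[OF U(3) N0(1,3)])
  have NU: "N \<subseteq> \<phi> ` (U \<inter> U')" unfolding N_def using N0(3,4) by (intro image_mono Int_greatest)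
  have h: "h holomorphic_on N"
    unfolding h_def by (rule holomorphic_on_subset[OF transition_holomorphic[OF U(1) U'(1)] NU])
  have invN: "inv_into U \<phi> z \<in> N0" if "z \<in> N" for z
  proof -
    from that obtain y where "y \<in> N0" "z = \<phi> y" unfolding N_def by blast
    moreover from this N0(3) have "y \<in> U" by blast
    ultimately show ?thesis by (simp add: chart_inv[OF U(3)])
  qed
  have L: "L holomorphic_on N"
  proof (rule analytic_imp_holomorphic, subst analytic_on_analytic_at, rule ballI)
    fix z assume z: "z \<in> N"
    then obtain y where y: "y \<in> N0" "z = \<phi> y" unfolding N_def by blast
    have "surface_holomorphic_on \<A> l N0" using l unfolding nonvanishing_holomorphic_on_def by (rule conjunct1)
    from surface_holomorphic_on_chart[OF this N0(1) U(1) subsetD[OF N0(3) y(1)] y(1)]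
    show "L analytic_on {z}" unfolding L_def y(2) .
  qed
  have L0: "L z \<noteq> 0" if "z \<in> N" for z
    using l invN[OF that] by (simp add: nonvanishing_holomorphic_on_def L_def)
  have h0: "deriv h z \<noteq> 0" if z: "z \<in> N" for z
  proof -
    from z obtain y where y: "y \<in> N0" "z = \<phi> y" unfolding N_def by blast
    from transition_analytic(2)[OF U(1) U'(1) subsetD[OF N0(3) y(1)] subsetD[OF N0(4) y(1)]]
    show ?thesis unfolding h_def y(2) .
  qed
  show thesis
  proof (rule that[OF N _ NU])
    show "\<phi> x \<in> N" unfolding N_def using N0(2) by (rule imageI)
    show "\<mu> holomorphic_on N"
      unfolding \<mu>_def
      by (intro holomorphic_on_mult holomorphic_on_prod holomorphic_on_power holomorphic_on_const L
          holomorphic_deriv h N)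
    show "\<mu> z \<noteq> 0" if "z \<in> N" for z
      using L0[OF that] h0[OF that] T(2) by (simp add: \<mu>_def)
    fix s z assume s: "\<forall>y. p (s y) = y" and z: "z \<in> N"
      and an: "\<forall>m<n. (\<lambda>\<zeta>. vec_index ((\<psi>' \<circ> s \<circ> inv_into U' \<phi>') \<zeta>) m)
        analytic_on {(\<phi>' \<circ> inv_into U \<phi>) z}"
    have an': "\<And>m. m < n \<Longrightarrow> (\<lambda>\<zeta>. vec_index ((\<psi>' \<circ> s \<circ> inv_into U' \<phi>') \<zeta>) m) analytic_on {h z}"
      using an unfolding h_def by blast
    have eq: "vec_index ((\<psi> \<circ> s \<circ> inv_into U \<phi>) \<zeta>) j =
        L \<zeta> * (\<Sum>m<n. T $$ (m, j) * vec_index ((\<psi>' \<circ> s \<circ> inv_into U' \<phi>') (h \<zeta>)) m)"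
      if \<zeta>: "\<zeta> \<in> N" and j: "j < n" for \<zeta> j
    proof -
      define y where "y = inv_into U \<phi> \<zeta>"
      have y: "y \<in> N0" unfolding y_def by (rule invN[OF \<zeta>])
      have "(\<psi>' \<circ> s \<circ> inv_into U' \<phi>') (h \<zeta>) = \<psi>' (s y)"
        unfolding h_def using chart_inv[OF U'(3) subsetD[OF N0(4) y]] by (simp add: y_def)
      moreover have "vec_index (\<psi> (s y)) j = l y * (\<Sum>m<n. T $$ (m, j) * vec_index (\<psi>' (s y)) m)"
        using e[of "s y" j] y j by (simp only: s[rule_format])
      ultimately show ?thesis by (simp add: L_def y_def)
    qed
    show "section_wronskian n s U \<phi> \<psi> z =
        \<mu> z * section_wronskian n s U' \<phi>' \<psi>' ((\<phi>' \<circ> inv_into U \<phi>) z)"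
      unfolding section_wronskian_def \<mu>_def h_def[symmetric]
      by (rule det_wronskian_change[OF N L h T(1) eq z an'])
  qed
qed

section \<open>The Wronskian of one meromorphic section in flat charts\<close>

context
  fixes s :: "'a \<Rightarrow> 'e"
  assumes mero: "meromorphic_section \<A> n p \<B> s"
begin

text \<open>Meromorphy is given in the frames of \<open>\<B>\<close>, while \<psi> is compared only
  with \<open>\<F>\<close>. A frame \<chi> of \<open>\<F>\<close> links the two: \<psi> = l \<chi> T
  with T constant, and \<chi> = \<beta> g with \<open>g\<close> holomorphic.\<close>

lemma section_component_meromorphic:
  assumes c: "flat_chart \<A> n p \<F> U \<phi> \<psi>" "x \<in> U" and j: "j < n"
  shows "(\<lambda>\<zeta>. vec_index ((\<psi> \<circ> s \<circ> inv_into U \<phi>) \<zeta>) j) meromorphic_on {\<phi> x}"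
proof -
  note U = flat_chartD[OF c(1)]
  have ps: "p (s y) = y" for y using mero by (simp add: meromorphic_section_def)
  obtain V \<chi> where V: "(V, \<chi>) \<in> \<F>" "x \<in> V" by (rule flat_frame_around)
  obtain W \<beta> where W: "(W, \<beta>) \<in> \<B>" "x \<in> W" by (rule frame_around)
  have oV: "open V" by (rule trivialization_overD(1)[OF flat_trivializations[OF V(1)]])
  have oW: "open W" by (rule trivialization_overD(1)[OF trivializations[OF W(1)]])
  obtain N l T where N: "open N" "x \<in> N" "N \<subseteq> U" "N \<subseteq> V"
    and "T \<in> GL_mat n" and l: "nonvanishing_holomorphic_on \<A> l N"
    and e: "\<And>e. p e \<in> N \<Longrightarrow> \<psi> e = l (p e) \<cdot>\<^sub>v row_mult (\<chi> e) T"
    by (rule flat_trivialization_local[OF U(2) V(1) c(2) V(2)]) (rule that)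
  have T: "T \<in> carrier_mat n n" using \<open>T \<in> GL_mat n\<close> by (simp add: GL_mat_def)
  from flat_holomorphic[OF V(1) W(1)] obtain g
    where g: "\<forall>x\<in>V \<inter> W. g x \<in> GL_mat n"
      "\<forall>i<n. \<forall>j<n. surface_holomorphic_on \<A> (\<lambda>x. g x $$ (i, j)) (V \<inter> W)"
      "\<forall>e. p e \<in> V \<inter> W \<longrightarrow> \<chi> e = row_mult (\<beta> e) (g (p e))"
    unfolding holomorphic_transition_def prod.case by (elim exE conjE)
  \<comment> \<open>The j-th coordinate of l (\<beta> g) T, written out in functions whose
    holomorphy or meromorphy is known.\<close>
  define F where "F = (\<lambda>\<zeta>. (l \<circ> inv_into U \<phi>) \<zeta> * (\<Sum>k<n. T $$ (k, j) *
    (\<Sum>m<n. ((\<lambda>y. g y $$ (m, k)) \<circ> inv_into U \<phi>) \<zeta> *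
      ((\<lambda>y. vec_index (\<beta> (s y)) m) \<circ> inv_into U \<phi>) \<zeta>)))"
  have "F meromorphic_on {\<phi> x}"
    unfolding F_def
  proof (intro meromorphic_on_mult meromorphic_on_sum meromorphic_on_const)
    have "surface_holomorphic_on \<A> l N" using l unfolding nonvanishing_holomorphic_on_def by (rule conjunct1)
    from surface_holomorphic_on_chart[OF this N(1) U(1) c(2) N(2)]
    show "(l \<circ> inv_into U \<phi>) meromorphic_on {\<phi> x}" by (rule analytic_on_imp_meromorphic_on)
    fix k m assume km: "k \<in> {..<n}" "m \<in> {..<n}"
    then have "surface_holomorphic_on \<A> (\<lambda>x. g x $$ (m, k)) (V \<inter> W)" using g(2) by simp
    from surface_holomorphic_on_chart[OF this open_Int[OF oV oW] U(1) c(2) IntI[OF V(2) W(2)]]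
    show "((\<lambda>y. g y $$ (m, k)) \<circ> inv_into U \<phi>) meromorphic_on {\<phi> x}"
      by (rule analytic_on_imp_meromorphic_on)
    have "surface_meromorphic_on \<A> (\<lambda>y. vec_index (\<beta> (s y)) m) W"
      using mero W(1) km(2) by (auto simp: meromorphic_section_def)
    from surface_meromorphic_on_chart[OF this U(1) c(2) W(2)]
    show "((\<lambda>y. vec_index (\<beta> (s y)) m) \<circ> inv_into U \<phi>) meromorphic_on {\<phi> x}" .
  qed
  moreover have "\<forall>\<^sub>F \<zeta> in at (\<phi> x). vec_index ((\<psi> \<circ> s \<circ> inv_into U \<phi>) \<zeta>) j = F \<zeta>"
  proof -
    have "open (N \<inter> W)" by (rule open_Int[OF N(1) oW])
    then have "\<forall>\<^sub>F y in at x. y \<in> N \<inter> W" using N(2) W(2) by (intro eventually_at_in_open') simp_all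
    then have "\<forall>\<^sub>F \<zeta> in at (\<phi> x). inv_into U \<phi> \<zeta> \<in> N \<inter> W"
      by (rule eventually_at_chart_inv[OF U(3) c(2), THEN iffD2])
    then show ?thesis
    proof eventually_elim
      case (elim \<zeta>)
      define y where "y = inv_into U \<phi> \<zeta>"
      have y: "y \<in> N" "y \<in> W" "y \<in> V" using elim N(4) by (auto simp: y_def)
      have \<beta>: "\<beta> (s y) \<in> carrier_vec n"
        using trivialization_overD(2)[OF trivializations[OF W(1)], of "s y"] y(2) by (simp add: ps)
      have gy: "g y \<in> carrier_mat n n" using g(1) y by (simp add: GL_mat_def)
      have \<chi>: "\<chi> (s y) = row_mult (\<beta> (s y)) (g y)" using g(3)[rule_format, of "s y"] y by (simp add: ps)
      have \<chi>': "\<chi> (s y) \<in> carrier_vec n" unfolding \<chi> by (rule row_mult_carrier[OF gy])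
      have "\<psi> (s y) = l y \<cdot>\<^sub>v row_mult (\<chi> (s y)) T" using e[of "s y"] y by (simp add: ps)
      then have "vec_index (\<psi> (s y)) j = l y * vec_index (row_mult (\<chi> (s y)) T) j"
        using j carrier_vecD[OF row_mult_carrier[OF T]] by simp
      also have "vec_index (row_mult (\<chi> (s y)) T) j = (\<Sum>k<n. T $$ (k, j) * vec_index (\<chi> (s y)) k)"
        by (rule index_row_mult[OF T \<chi>' j])
      also have "\<dots> = (\<Sum>k<n. T $$ (k, j) * (\<Sum>m<n. g y $$ (m, k) * vec_index (\<beta> (s y)) m))"
        unfolding \<chi> by (intro sum.cong refl) (simp add: index_row_mult[OF gy \<beta>])
      finally show ?case by (simp add: F_def y_def)
    qed
  qed
  ultimately show ?thesis
    by (rule_tac iffD2[OF meromorphic_on_cong[OF _ refl]]) (simp_all only: singleton_iff)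
qed

lemma section_wronskian_meromorphic_at:
  assumes "flat_chart \<A> n p \<F> U \<phi> \<psi>" "x \<in> U"
  shows "section_wronskian n s U \<phi> \<psi> meromorphic_on {\<phi> x}"
  by (rule section_wronskian_meromorphic) (rule section_component_meromorphic[OF assms])

lemma eventually_section_analytic:
  assumes "flat_chart \<A> n p \<F> U \<phi> \<psi>" "x \<in> U"
  shows "\<forall>\<^sub>F z in at (\<phi> x). \<forall>m<n. (\<lambda>\<zeta>. vec_index ((\<psi> \<circ> s \<circ> inv_into U \<phi>) \<zeta>) m) analytic_on {z}"
proof -
  have "\<forall>\<^sub>F z in at (\<phi> x). \<forall>m\<in>{..<n}.
      (\<lambda>\<zeta>. vec_index ((\<psi> \<circ> s \<circ> inv_into U \<phi>) \<zeta>) m) analytic_on {z}"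
  proof (rule eventually_ball_finite, simp, rule ballI)
    fix m assume "m \<in> {..<n}"
    then have "m < n" by simp
    from meromorphic_imp_eventually_analytic[OF section_component_meromorphic[OF assms this]]
    show "\<forall>\<^sub>F z in at (\<phi> x). (\<lambda>\<zeta>. vec_index ((\<psi> \<circ> s \<circ> inv_into U \<phi>) \<zeta>) m) analytic_on {z}" .
  qed
  then show ?thesis by (simp add: Ball_def)
qed

text \<open>Off the point, the first Wronskian is \<mu> times the second composed with the
  transition \<open>h\<close>. The factor has order 0, and \<open>h\<close> preserves orders because
  its derivative is nonzero.\<close>

lemma zorder_section_wronskian_change:
  assumes c: "flat_chart \<A> n p \<F> U \<phi> \<psi>" "x \<in> U" and c': "flat_chart \<A> n p \<F> U' \<phi>' \<psi>'" "x \<in> U'"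
    and nz: "\<forall>\<^sub>F z in at (\<phi>' x). section_wronskian n s U' \<phi>' \<psi>' z \<noteq> 0"
  shows "zorder (section_wronskian n s U \<phi> \<psi>) (\<phi> x) = zorder (section_wronskian n s U' \<phi>' \<psi>') (\<phi>' x)"
proof -
  note U = flat_chartD[OF c(1)] and U' = flat_chartD[OF c'(1)]
  let ?w = "section_wronskian n s U \<phi> \<psi>" and ?w' = "section_wronskian n s U' \<phi>' \<psi>'"
  have ps: "\<forall>y. p (s y) = y" using mero by (simp add: meromorphic_section_def)
  obtain N \<mu> where N: "open N" "\<phi> x \<in> N" and \<mu>: "\<mu> holomorphic_on N" "\<And>z. z \<in> N \<Longrightarrow> \<mu> z \<noteq> 0"
    and change: "\<And>s z. (\<forall>y. p (s y) = y) \<Longrightarrow> z \<in> N \<Longrightarrow>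
      (\<forall>m<n. (\<lambda>\<zeta>. vec_index ((\<psi>' \<circ> s \<circ> inv_into U' \<phi>') \<zeta>) m)
        analytic_on {(\<phi>' \<circ> inv_into U \<phi>) z}) \<Longrightarrow>
      section_wronskian n s U \<phi> \<psi> z =
        \<mu> z * section_wronskian n s U' \<phi>' \<psi>' ((\<phi>' \<circ> inv_into U \<phi>) z)"
    by (rule wronskian_change[OF c c']) (rule that)
  define h where "h = \<phi>' \<circ> inv_into U \<phi>"
  have h: "h analytic_on {\<phi> x}" "deriv h (\<phi> x) \<noteq> 0"
    unfolding h_def by (rule transition_analytic[OF U(1) U'(1) c(2) c'(2)])+
  have hx: "h (\<phi> x) = \<phi>' x" unfolding h_def by (simp add: chart_inv[OF U(3) c(2)])
  have lim: "filterlim h (at (\<phi>' x)) (at (\<phi> x))"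
    using filterlim_at_regular[OF h] unfolding hx .
  have nz': "\<forall>\<^sub>F z in at (h (\<phi> x)). ?w' z \<noteq> 0" using nz unfolding hx .
  have mer': "?w' meromorphic_on {h (\<phi> x)}" unfolding hx by (rule section_wronskian_meromorphic_at[OF c'])
  have evN: "\<forall>\<^sub>F z in at (\<phi> x). z \<in> N" by (rule eventually_at_in_open'[OF N])
  \<comment> \<open>\<open>h\<close> sends a punctured neighbourhood of \<phi> x into one of \<phi>'
    x, on which the second components are analytic even if \<phi>' x is a pole.\<close>
  have eq: "\<forall>\<^sub>F z in at (\<phi> x). ?w z = \<mu> z * ?w' (h z)"
    using eventually_compose_filterlim[OF eventually_section_analytic[OF c'] lim] evN
    unfolding h_def by eventually_elim (rule change[OF ps])
  have \<mu>x: "\<mu> analytic_on {\<phi> x}" unfolding analytic_at using N \<mu>(1) by blast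
  have "zorder ?w (\<phi> x) = zorder (\<lambda>z. \<mu> z * ?w' (h z)) (\<phi> x)"
    by (rule zorder_cong[OF eq refl])
  also have "\<dots> = zorder \<mu> (\<phi> x) + zorder (\<lambda>z. ?w' (h z)) (\<phi> x)"
  proof (rule zorder_mult)
    show "\<mu> meromorphic_on {\<phi> x}" by (rule analytic_on_imp_meromorphic_on[OF \<mu>x])
    show "(\<lambda>z. ?w' (h z)) meromorphic_on {\<phi> x}"
      by (rule meromorphic_on_compose[OF mer' h(1)]) simp
    show "\<exists>\<^sub>F z in at (\<phi> x). \<mu> z \<noteq> 0"
      by (rule eventually_frequently[OF at_neq_bot eventually_mono[OF evN \<mu>(2)]])
    show "\<exists>\<^sub>F z in at (\<phi> x). ?w' (h z) \<noteq> 0"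
      by (rule eventually_frequently[OF at_neq_bot eventually_compose_filterlim[OF nz lim]])
  qed
  also have "zorder \<mu> (\<phi> x) = 0" by (rule zorder_eq_0I[OF \<mu>x \<mu>(2)[OF N(2)]])
  also have "zorder (\<lambda>z. ?w' (h z)) (\<phi> x) = zorder ?w' (h (\<phi> x))"
    by (rule zorder_compose_regular[OF mer' nz' h])
  finally show ?thesis by (simp add: hx)
qed

end

text \<open>The Wronskian read in a flat chart chosen separately at each point. It is not meromorphic, but
  its zeros and the quotients of two such functions do not depend on the choices.\<close>

definition pointwise_wronskian :: "('a \<Rightarrow> 'e) \<Rightarrow> 'a \<Rightarrow> complex" where
  "pointwise_wronskian s y =
     (case SOME (U, \<phi>, \<psi>). flat_chart \<A> n p \<F> U \<phi> \<psi> \<and> y \<in> U of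
       (U, \<phi>, \<psi>) \<Rightarrow> section_wronskian n s U \<phi> \<psi> (\<phi> y))"

text \<open>The choice depends on the point alone: the same chart is used there for every
  section.\<close>

lemma pointwise_wronskian_chart:
  obtains U \<phi> \<psi> where "flat_chart \<A> n p \<F> U \<phi> \<psi>" "y \<in> U"
    "\<And>s. pointwise_wronskian s y = section_wronskian n s U \<phi> \<psi> (\<phi> y)"
proof -
  define P where "P = (\<lambda>(U, \<phi>, \<psi>). flat_chart \<A> n p \<F> U \<phi> \<psi> \<and> y \<in> U)"
  obtain U0 \<phi>0 \<psi>0 where "flat_chart \<A> n p \<F> U0 \<phi>0 \<psi>0" "y \<in> U0" by (rule flat_chart_around)
  then have "P (U0, \<phi>0, \<psi>0)" by (simp add: P_def)
  then have P: "P (SOME c. P c)" by (rule someI)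
  obtain U \<phi> \<psi> where c: "(SOME c. P c) = (U, \<phi>, \<psi>)" by (cases "SOME c. P c")
  have "flat_chart \<A> n p \<F> U \<phi> \<psi>" "y \<in> U" using P unfolding c by (simp_all add: P_def)
  moreover have "pointwise_wronskian s y = section_wronskian n s U \<phi> \<psi> (\<phi> y)" for s
    unfolding pointwise_wronskian_def P_def[symmetric] c prod.case ..
  ultimately show thesis by (rule that)
qed

text \<open>The multiplier m may vary erratically with y, but it is shared by both sections.
  Quotients and zeros thus agree with those in the fixed flat chart.\<close>

lemma eventually_pointwise_wronskian:
  assumes s: "meromorphic_section \<A> n p \<B> s" and t: "meromorphic_section \<A> n p \<B> t"
    and c: "flat_chart \<A> n p \<F> U \<phi> \<psi>" "x \<in> U"
  shows "\<forall>\<^sub>F y in at x. \<exists>m. m \<noteq> 0 \<and>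
    pointwise_wronskian s y = m * section_wronskian n s U \<phi> \<psi> (\<phi> y) \<and>
    pointwise_wronskian t y = m * section_wronskian n t U \<phi> \<psi> (\<phi> y)"
proof -
  note U = flat_chartD[OF c(1)]
  have evU: "\<forall>\<^sub>F y in at x. y \<in> U" by (rule eventually_at_in_open'[OF U(4) c(2)])
  show ?thesis
    using eventually_at_chart[OF U(3) c(2), THEN iffD2, OF eventually_section_analytic[OF s c]]
      eventually_at_chart[OF U(3) c(2), THEN iffD2, OF eventually_section_analytic[OF t c]] evU
  proof eventually_elim
    case (elim y)
    obtain V \<chi> \<theta> where V: "flat_chart \<A> n p \<F> V \<chi> \<theta>" "y \<in> V"
      and w: "\<And>s. pointwise_wronskian s y = section_wronskian n s V \<chi> \<theta> (\<chi> y)"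
      by (rule pointwise_wronskian_chart) (rule that)
    obtain N \<mu> where N: "open N" "\<chi> y \<in> N" and \<mu>: "\<And>z. z \<in> N \<Longrightarrow> \<mu> z \<noteq> 0"
      and change: "\<And>s z. (\<forall>y. p (s y) = y) \<Longrightarrow> z \<in> N \<Longrightarrow>
        (\<forall>m<n. (\<lambda>\<zeta>. vec_index ((\<psi> \<circ> s \<circ> inv_into U \<phi>) \<zeta>) m)
          analytic_on {(\<phi> \<circ> inv_into V \<chi>) z}) \<Longrightarrow>
        section_wronskian n s V \<chi> \<theta> z =
          \<mu> z * section_wronskian n s U \<phi> \<psi> ((\<phi> \<circ> inv_into V \<chi>) z)"
      \<comment> \<open>The change goes from the chart chosen at y to the fixed one, so analyticity
        is required only in the fixed chart, where it holds for all y near x other than x.\<close>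
      by (rule wronskian_change[OF V c(1) elim(3)]) (rule that)
    have y: "(\<phi> \<circ> inv_into V \<chi>) (\<chi> y) = \<phi> y"
      by (simp add: chart_inv[OF flat_chartD(3)[OF V(1)] V(2)])
    have "\<forall>y. p (s y) = y" "\<forall>y. p (t y) = y" using s t by (simp_all add: meromorphic_section_def)
    note ps = this
    have "section_wronskian n s V \<chi> \<theta> (\<chi> y) = \<mu> (\<chi> y) * section_wronskian n s U \<phi> \<psi> (\<phi> y)"
      by (rule change[OF ps(1) N(2), unfolded y]) (rule elim(1))
    moreover have "section_wronskian n t V \<chi> \<theta> (\<chi> y) = \<mu> (\<chi> y) * section_wronskian n t U \<phi> \<psi> (\<phi> y)"
      by (rule change[OF ps(2) N(2), unfolded y]) (rule elim(2))
    ultimately show ?case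
      unfolding w using \<mu>[OF N(2)] by (intro exI[of _ "\<mu> (\<chi> y)"] conjI)
  qed
qed

text \<open>Taking \<open>Q\<close> to be the identity or \<open>Not\<close> covers both
  alternatives of the local dichotomy.\<close>

lemma eventually_pointwise_wronskian_iff:
  assumes s: "meromorphic_section \<A> n p \<B> s" and c: "flat_chart \<A> n p \<F> U \<phi> \<psi>" "x \<in> U"
  shows "(\<forall>\<^sub>F y in at x. Q (pointwise_wronskian s y = 0)) \<longleftrightarrow>
    (\<forall>\<^sub>F z in at (\<phi> x). Q (section_wronskian n s U \<phi> \<psi> z = 0))"
proof -
  have "\<forall>\<^sub>F y in at x. Q (pointwise_wronskian s y = 0) = Q (section_wronskian n s U \<phi> \<psi> (\<phi> y) = 0)"
    using eventually_pointwise_wronskian[OF s s c]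
  proof eventually_elim
    case (elim y)
    then have "pointwise_wronskian s y = 0 \<longleftrightarrow> section_wronskian n s U \<phi> \<psi> (\<phi> y) = 0"
      by (elim exE conjE) (simp only: mult_eq_0_iff simp_thms)
    then show ?case by (simp only:)
  qed
  from eventually_subst[OF this] show ?thesis
    unfolding eventually_at_chart[OF flat_chartD(3)[OF c(1)] c(2), of "\<lambda>z. Q (section_wronskian n s U \<phi> \<psi> z = 0)"] .
qed

text \<open>Genericity concerns a single flat chart. Since \<open>pointwise_wronskian\<close> is
  defined on the whole surface, the connectedness argument can be applied to its zeros, with the
  dichotomy imported from a flat chart around each point.\<close>

lemma pointwise_wronskian_nonzero:
  assumes s: "meromorphic_section \<A> n p \<B> s" and gen: "generic_section \<A> n p \<F> s"
  shows "\<forall>\<^sub>F y in at x. pointwise_wronskian s y \<noteq> 0"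
proof -
  have dich: "(\<forall>\<^sub>F y in at x. pointwise_wronskian s y \<noteq> 0) \<or>
      (\<forall>\<^sub>F y in at x. \<not> pointwise_wronskian s y \<noteq> 0)" for x
  proof -
    obtain U \<phi> \<psi> where c: "flat_chart \<A> n p \<F> U \<phi> \<psi>" "x \<in> U" by (rule flat_chart_around)
    from meromorphic_at_dichotomy[OF section_wronskian_meromorphic_at[OF s c]] show ?thesis
      using eventually_pointwise_wronskian_iff[OF s c, of Not]
        eventually_pointwise_wronskian_iff[OF s c, of "\<lambda>b. b"] by (simp only: not_not)
  qed
  obtain U \<phi> \<psi> x0 where c: "flat_chart \<A> n p \<F> U \<phi> \<psi>" "x0 \<in> U"
    and freq: "\<exists>\<^sub>F z in at (\<phi> x0). section_wronskian n s U \<phi> \<psi> z \<noteq> 0"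
    using gen unfolding generic_section_def not_identically_zero_on_def by blast
  have "\<exists>\<^sub>F y in at x0. pointwise_wronskian s y \<noteq> 0"
    using freq eventually_pointwise_wronskian_iff[OF s c, of "\<lambda>b. b"]
    by (simp add: frequently_def)
  with dich show ?thesis
    by (rule connected_eventually_at[OF connected_surface surface_at_neq_bot])
qed

lemma section_wronskian_nonzero:
  assumes s: "meromorphic_section \<A> n p \<B> s" "generic_section \<A> n p \<F> s"
    and c: "flat_chart \<A> n p \<F> U \<phi> \<psi>" "x \<in> U"
  shows "\<forall>\<^sub>F z in at (\<phi> x). section_wronskian n s U \<phi> \<psi> z \<noteq> 0"
  using pointwise_wronskian_nonzero[OF s, of x]
    eventually_pointwise_wronskian_iff[OF s(1) c, of Not] by (simp only:)

text \<open>The given flat chart is among those tested, so the value is unique; genericity enters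
  because comparing orders requires a Wronskian that is nonzero near x.\<close>

lemma section_divisor_eq:
  assumes s: "meromorphic_section \<A> n p \<B> s" "generic_section \<A> n p \<F> s"
    and c: "flat_chart \<A> n p \<F> U \<phi> \<psi>" "x \<in> U"
  shows "section_divisor \<A> n p \<F> s x = zorder (section_wronskian n s U \<phi> \<psi>) (\<phi> x)"
  unfolding section_divisor_def
proof (rule the_equality)
  show "\<forall>U' \<phi>' \<psi>'. flat_chart \<A> n p \<F> U' \<phi>' \<psi>' \<and> x \<in> U' \<longrightarrow>
      zorder (section_wronskian n s U' \<phi>' \<psi>') (\<phi>' x) = zorder (section_wronskian n s U \<phi> \<psi>) (\<phi> x)"
  proof (intro allI impI, elim conjE)
    fix U' \<phi>' \<psi>' assume "flat_chart \<A> n p \<F> U' \<phi>' \<psi>'" "x \<in> U'"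
    from zorder_section_wronskian_change[OF s(1) this c section_wronskian_nonzero[OF s c]]
    show "zorder (section_wronskian n s U' \<phi>' \<psi>') (\<phi>' x) = zorder (section_wronskian n s U \<phi> \<psi>) (\<phi> x)" .
  qed
  fix k assume "\<forall>U' \<phi>' \<psi>'. flat_chart \<A> n p \<F> U' \<phi>' \<psi>' \<and> x \<in> U' \<longrightarrow>
      zorder (section_wronskian n s U' \<phi>' \<psi>') (\<phi>' x) = k"
  with c have "zorder (section_wronskian n s U \<phi> \<psi>) (\<phi> x) = k" by simp
  then show "k = zorder (section_wronskian n s U \<phi> \<psi>) (\<phi> x)" by (rule sym)
qed

text \<open>In a flat chart around x the Wronskian is analytic and nonzero at every nearby point
  other than x, so x is the only possible point of the support close to x.\<close>

lemma section_divisor_in_divisor_group: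
  assumes s: "meromorphic_section \<A> n p \<B> s" "generic_section \<A> n p \<F> s"
  shows "section_divisor \<A> n p \<F> s \<in> carrier divisor_group"
proof -
  have "\<exists>N. open N \<and> x \<in> N \<and> finite {y \<in> N. section_divisor \<A> n p \<F> s y \<noteq> 0}" for x
  proof -
    obtain U \<phi> \<psi> where c: "flat_chart \<A> n p \<F> U \<phi> \<psi>" "x \<in> U" by (rule flat_chart_around)
    note U = flat_chartD[OF c(1)]
    let ?w = "section_wronskian n s U \<phi> \<psi>"
    have "\<forall>\<^sub>F z in at (\<phi> x). zorder ?w z = 0"
      using section_wronskian_nonzero[OF s c]
        meromorphic_imp_eventually_analytic[OF section_wronskian_meromorphic_at[OF s(1) c]]
      by eventually_elim (rule zorder_eq_0I)
    then have "\<forall>\<^sub>F y in at x. zorder ?w (\<phi> y) = 0"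
      by (rule eventually_at_chart[OF U(3) c(2), THEN iffD2])
    moreover have "\<forall>\<^sub>F y in at x. y \<in> U" by (rule eventually_at_in_open'[OF U(4) c(2)])
    \<comment> \<open>The flat chart around x is also a flat chart around each nearby y and computes
      the divisor there.\<close>
    ultimately have "\<forall>\<^sub>F y in at x. section_divisor \<A> n p \<F> s y = 0"
      by eventually_elim (simp only: section_divisor_eq[OF s c(1)])
    then obtain N where N: "open N" "x \<in> N"
      "\<And>y. y \<in> N \<Longrightarrow> y \<noteq> x \<Longrightarrow> section_divisor \<A> n p \<F> s y = 0"
      unfolding eventually_at_topological by blast
    have "{y \<in> N. section_divisor \<A> n p \<F> s y \<noteq> 0} \<subseteq> {x}" using N(3) by blast
    then have "finite {y \<in> N. section_divisor \<A> n p \<F> s y \<noteq> 0}"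
      by (rule finite_subset) simp
    with N(1,2) show ?thesis by (intro exI[of _ N] conjI)
  qed
  then show ?thesis by (simp add: divisor_group_def)
qed

lemma section_divisor_diff_principal:
  assumes s: "meromorphic_section \<A> n p \<B> s" "generic_section \<A> n p \<F> s"
    and t: "meromorphic_section \<A> n p \<B> t" "generic_section \<A> n p \<F> t"
  shows "(\<lambda>x. section_divisor \<A> n p \<F> s x - section_divisor \<A> n p \<F> t x) \<in> principal_divisors \<A>"
proof -
  \<comment> \<open>Where the denominator vanishes the value is 0 by convention; such points are
    isolated by genericity of \<open>t\<close>, so this affects neither meromorphy nor
    orders.\<close>
  define f where "f = (\<lambda>y. pointwise_wronskian s y / pointwise_wronskian t y)"
  have nz: "\<forall>\<^sub>F y in at x. f y \<noteq> 0" for x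
    using pointwise_wronskian_nonzero[OF s, of x] pointwise_wronskian_nonzero[OF t, of x]
    by eventually_elim (simp add: f_def)
  have local: "(f \<circ> inv_into U \<phi>) meromorphic_on {\<phi> x} \<and> zorder (f \<circ> inv_into U \<phi>) (\<phi> x) =
      section_divisor \<A> n p \<F> s x - section_divisor \<A> n p \<F> t x"
    if U: "(U, \<phi>) \<in> \<A>" "x \<in> U" for U \<phi> x
  proof -
    obtain W \<psi> where c: "flat_chart \<A> n p \<F> W \<phi> \<psi>" "x \<in> W" and WU: "W \<subseteq> U"
      by (rule flat_chart_exists[OF U])
    note W = flat_chartD[OF c(1)]
    let ?w = "\<lambda>s. section_wronskian n s W \<phi> \<psi>"
    \<comment> \<open>The common nonzero multiplier cancels, leaving a quotient of two meromorphic
      functions of one coordinate.\<close>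
    have "\<forall>\<^sub>F y in at x. f y = ?w s (\<phi> y) / ?w t (\<phi> y)"
      using eventually_pointwise_wronskian[OF s(1) t(1) c]
      by eventually_elim (elim exE conjE, simp add: f_def)
    moreover have "\<forall>\<^sub>F y in at x. y \<in> U"
      by (rule eventually_at_in_open'[OF chart_open[OF charts[OF U(1)]] U(2)])
    ultimately have "\<forall>\<^sub>F y in at x. (f \<circ> inv_into U \<phi>) (\<phi> y) = ?w s (\<phi> y) / ?w t (\<phi> y)"
      by eventually_elim (simp add: chart_inv[OF charts[OF U(1)]])
    then have eq: "\<forall>\<^sub>F z in at (\<phi> x). (f \<circ> inv_into U \<phi>) z = ?w s z / ?w t z"
      by (rule eventually_at_chart[OF W(3) c(2), THEN iffD1])
    have mer: "?w s meromorphic_on {\<phi> x}" "?w t meromorphic_on {\<phi> x}"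
      by (rule section_wronskian_meromorphic_at[OF s(1) c] section_wronskian_meromorphic_at[OF t(1) c])+
    have nz: "\<exists>\<^sub>F z in at (\<phi> x). ?w s z \<noteq> 0" "\<exists>\<^sub>F z in at (\<phi> x). ?w t z \<noteq> 0"
      by (rule eventually_frequently[OF at_neq_bot section_wronskian_nonzero[OF s c]]
          eventually_frequently[OF at_neq_bot section_wronskian_nonzero[OF t c]])+
    have "(f \<circ> inv_into U \<phi>) meromorphic_on {\<phi> x} \<longleftrightarrow> (\<lambda>z. ?w s z / ?w t z) meromorphic_on {\<phi> x}"
      by (rule meromorphic_on_cong[OF _ refl]) (use eq in \<open>simp only: singleton_iff\<close>)
    then have "(f \<circ> inv_into U \<phi>) meromorphic_on {\<phi> x}"
      using meromorphic_on_divide[OF mer] by (rule iffD2)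
    moreover have "zorder (f \<circ> inv_into U \<phi>) (\<phi> x) = zorder (?w s) (\<phi> x) - zorder (?w t) (\<phi> x)"
      using zorder_cong[OF eq refl] zorder_divide[OF mer(1) nz(1) mer(2) nz(2)] by (rule trans)
    ultimately show ?thesis
      unfolding section_divisor_eq[OF s c] section_divisor_eq[OF t c] by (rule conjI)
  qed
  have mero: "surface_meromorphic_on \<A> f UNIV"
    unfolding surface_meromorphic_on_def
  proof (intro ballI, clarify)
    fix U \<phi> assume U: "(U, \<phi>) \<in> \<A>"
    have "\<forall>z\<in>\<phi> ` (U \<inter> UNIV). (f \<circ> inv_into U \<phi>) meromorphic_on {z}"
      using local[OF U] by blast
    then show "(f \<circ> inv_into U \<phi>) meromorphic_on \<phi> ` (U \<inter> UNIV)"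
      by (rule meromorphic_on_meromorphic_at[THEN iffD2])
  qed
  have "not_identically_zero_on f UNIV"
    unfolding not_identically_zero_on_def using eventually_frequently[OF surface_at_neq_bot nz] by blast
  moreover have "surface_order \<A> f x = section_divisor \<A> n p \<F> s x - section_divisor \<A> n p \<F> t x" for x
  proof -
    obtain U \<phi> where U: "(U, \<phi>) \<in> \<A>" "x \<in> U" by (rule atlas_chart_around)
    show ?thesis
      using surface_order_eq[OF mero nz U] local[OF U, THEN conjunct2] by (rule trans)
  qed
  then have "(\<lambda>x. section_divisor \<A> n p \<F> s x - section_divisor \<A> n p \<F> t x) = surface_order \<A> f"
    by (intro ext) (rule sym)
  ultimately show ?thesis
    unfolding principal_divisors_def mem_Collect_eq using mero by (intro exI[of _ f] conjI)
qed

text \<open>With S and T the two divisors, E + S = (E + (S - T)) + T, and the bracket is principal.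
  Exchanging the sections gives the reverse inclusion.\<close>

lemma divisor_class_subset:
  assumes s: "meromorphic_section \<A> n p \<B> s" "generic_section \<A> n p \<F> s"
    and t: "meromorphic_section \<A> n p \<B> t" "generic_section \<A> n p \<F> t"
  shows "divisor_class \<A> (section_divisor \<A> n p \<F> s) \<subseteq> divisor_class \<A> (section_divisor \<A> n p \<F> t)"
proof
  let ?S = "section_divisor \<A> n p \<F> s" and ?T = "section_divisor \<A> n p \<F> t"
  fix D assume "D \<in> divisor_class \<A> ?S"
  then obtain E where E: "E \<in> principal_divisors \<A>" "D = (\<lambda>x. E x + ?S x)"
    by (auto simp: divisor_class_def r_coset_def divisor_group_def)
  have "(\<lambda>x. E x + (?S x - ?T x)) \<in> principal_divisors \<A>"
    by (rule principal_divisors_add[OF E(1) section_divisor_diff_principal[OF s t]])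
  moreover have "D = (\<lambda>x. (E x + (?S x - ?T x)) + ?T x)" by (simp add: E(2))
  ultimately show "D \<in> divisor_class \<A> ?T"
    unfolding divisor_class_def r_coset_def divisor_group_def by (simp only: monoid.simps) blast
qed

end

theorem lemma5p1:
  fixes \<A> :: "('a::t2_space) coordinate set"
    and n :: nat
    and p :: "'e \<Rightarrow> 'a"
    and \<B> \<F> :: "('a, 'e) trivialization set"
    and A B :: "'a \<Rightarrow> 'e"
  assumes "projectively_flat_bundle \<A> n p \<B> \<F>"
    and "meromorphic_section \<A> n p \<B> A" and "generic_section \<A> n p \<F> A"
    and "meromorphic_section \<A> n p \<B> B" and "generic_section \<A> n p \<F> B"
  shows "section_divisor \<A> n p \<F> A \<in> carrier divisor_group \<and>
    section_divisor \<A> n p \<F> B \<in> carrier divisor_group \<and>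
    divisor_class \<A> (section_divisor \<A> n p \<F> A) \<in> carrier (picard_group \<A>) \<and>
    divisor_class \<A> (section_divisor \<A> n p \<F> A) = divisor_class \<A> (section_divisor \<A> n p \<F> B)"
proof -
  interpret projectively_flat_bundle \<A> n p \<B> \<F> by (rule assms(1))
  have A: "section_divisor \<A> n p \<F> A \<in> carrier divisor_group"
    by (rule section_divisor_in_divisor_group[OF assms(2,3)])
  then have "divisor_class \<A> (section_divisor \<A> n p \<F> A) \<in> carrier (picard_group \<A>)"
    unfolding picard_group_def FactGroup_def RCOSETS_def divisor_class_def by auto
  moreover have "section_divisor \<A> n p \<F> B \<in> carrier divisor_group"
    by (rule section_divisor_in_divisor_group[OF assms(4,5)])
  moreover have "divisor_class \<A> (section_divisor \<A> n p \<F> A) = divisor_class \<A> (section_divisor \<A> n p \<F> B)"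
    by (intro equalityI divisor_class_subset assms(2-5))
  ultimately show ?thesis using A by (intro conjI)
qed

end
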